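(* Let $p \geq 11$ be a prime. Then $$\mathcal{W}_p \equiv \sum_{\nu=1}^{6} \omega_\nu \, p^{\nu-1} \pmod{p^6}$$ and equivalently $$(p-1)! \equiv \sum_{\nu=0}^{6} \omega_\nu \, p^\nu \pmod{p^7},$$ where $\omega_0 = -1$ and $\omega_1,\ldots,\omega_6 \in \mathbb{Z}_p$ are given by $$\omega_1 \equiv -6 \overline{\mathcal{B}}_1 + 15 \overline{\mathcal{B}}_2 - 20 \overline{\mathcal{B}}_3 + 15 \overline{\mathcal{B}}_4 - 6 \overline{\mathcal{B}}_5 + \overline{\mathcal{B}}_6 \pmod{p^6},$$ $$\omega_2 \equiv \overline{\mathcal{B}}_1 \left(-\tfrac{13}{2} \overline{\mathcal{B}}_1 + 15 \overline{\mathcal{B}}_2 - 9 \overline{\mathcal{B}}_3 + 2 \overline{\mathcal{B}}_4\right) + \overline{\mathcal{B}}_2 \left(-\tfrac{7}{2} \overline{\mathcal{B}}_2 + 3 \overline{\mathcal{B}}_4 - \overline{\mathcal{B}}_5\right) - \tfrac{1}{2} \overline{\mathcal{B}}_3^2 \pmod{p^5},$$ $$\omega_3 \equiv \overline{\mathcal{B}}_1^2 \left(-\tfrac{10}{3} \overline{\mathcal{B}}_1 + \tfrac{15}{2} \overline{\mathcal{B}}_2 - 3 \overline{\mathcal{B}}_3 + \tfrac{1}{2} \overline{\mathcal{B}}_4\right) + \overline{\mathcal{B}}_2^2 \left(-3 \overline{\mathcal{B}}_1 + \tfrac{1}{6} \overline{\mathcal{B}}_2\right) + \overline{\mathcal{B}}_1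 \overline{\mathcal{B}}_2 \overline{\mathcal{B}}_3 - \tfrac{4}{3} \overline{\mathcal{B}}_{1,2} + 2 \overline{\mathcal{B}}_{2,2} - \tfrac{4}{3} \overline{\mathcal{B}}_{3,2} + \tfrac{1}{3} \overline{\mathcal{B}}_{4,2} \pmod{p^4},$$ $$\omega_4 \equiv \overline{\mathcal{B}}_1^3 \left(-\tfrac{5}{8} \overline{\mathcal{B}}_1 + \overline{\mathcal{B}}_2 - \tfrac{1}{6} \overline{\mathcal{B}}_3\right) - \tfrac{1}{4} \overline{\mathcal{B}}_1^2 \overline{\mathcal{B}}_2^2 - \overline{\mathcal{B}}_1 \overline{\mathcal{B}}_{1,2} + \overline{\mathcal{B}}_2 \overline{\mathcal{B}}_{2,2} - \tfrac{1}{3} \overline{\mathcal{B}}_3 \overline{\mathcal{B}}_{3,2} \pmod{p^3},$$ $$\omega_5 \equiv -\tfrac{1}{20} \overline{\mathcal{B}}_1^5 + \tfrac{1}{24} \overline{\mathcal{B}}_1^4 \overline{\mathcal{B}}_2 - \tfrac{1}{3} \overline{\mathcal{B}}_1 \overline{\mathcal{B}}_2 \overline{\mathcal{B}}_{1,2} - \tfrac{1}{2} \overline{\mathcal{B}}_1^2 \overline{\mathcal{B}}_{2,2} + \tfrac{2}{3} \overline{\mathcal{B}}_1 \overline{\mathcal{B}}_2 \overline{\mathcal{B}}_{2,2} - \tfrac{2}{5} \overline{\mathcal{B}}_{1,4} + \tfrac{1}{5} \overline{\mathcal{B}}_{2,4} \pmod{p^2},$$ $$\omega_6 \equiv -\tfrac{1}{720}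 \overline{\mathcal{B}}_1^6 - \tfrac{1}{18} \overline{\mathcal{B}}_1^3 \overline{\mathcal{B}}_{1,2} - \tfrac{1}{18} \overline{\mathcal{B}}_{1,2}^2 - \tfrac{1}{5} \overline{\mathcal{B}}_1 \overline{\mathcal{B}}_{1,4} \pmod{p}.$$
   Context: For a prime $p$, the Wilson quotient is $\mathcal{W}_p = \frac{(p-1)!+1}{p}$, an integer by Wilson's theorem. The Bernoulli numbers $B_n \in \mathbb{Q}$ are defined by $\frac{t}{e^t-1} = \sum_{n \geq 0} B_n \frac{t^n}{n!}$. For a prime $p \geq 7$ and integers $n \geq 1$, define the divided Bernoulli numbers $$\overline{\mathcal{B}}_n = \frac{B_{n(p-1)} + \frac{1}{p} - 1}{n(p-1)}, \qquad \overline{\mathcal{B}}_{n,d} = \frac{B_{n(p-1)-d}}{n(p-1)-d} \quad (d \in \{2,4\}).$$ For the indices occurring in the claim these are $p$-integral rational numbers, i.e. elements of $\mathbb{Q} \cap \mathbb{Z}_p$, where $\mathbb{Z}_p$ is the ring of $p$-adic integers. Subscripts $\overline{\mathcal{B}}_{n,d}$ have first index $n$ and second index $d$. A congruence $a \equiv b \pmod{p^k}$ between elements of $\mathbb{Z}_p$ means $a - b \in p^k \mathbb{Z}_p$. *)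

theory Defs
  imports
    "HOL-Algebra.Ideal"
    "HOL-Computational_Algebra.Computational_Algebra"
    "HOL-Number_Theory.Modular_Inverse"
begin

section \<open>The ring of \<open>p\<close>-adic integers\<close>

text \<open>
  \<open>\<int>\<^sub>p\<close> is the inverse limit of the rings \<open>\<int>/p\<^sup>n\<close>: an element is a compatible family of
  residues, the \<open>n\<close>-th one normalised to lie in \<open>{0..<p\<^sup>n}\<close>.
\<close>

type_synonym padic = "nat \<Rightarrow> int"

definition padic_ints :: "nat \<Rightarrow> padic ring" where
  "padic_ints p = \<lparr>
     carrier = {x. \<forall>n. x n \<in> {0..<int p ^ n} \<and> x (Suc n) mod int p ^ n = x n},
     monoid.mult = (\<lambda>x y n. (x n * y n) mod int p ^ n),
     one = (\<lambda>n. 1 mod int p ^ n),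
     zero = (\<lambda>n. 0),
     add = (\<lambda>x y n. (x n + y n) mod int p ^ n)\<rparr>"

definition p_integral :: "nat \<Rightarrow> rat \<Rightarrow> bool" where
  "p_integral p r \<longleftrightarrow> coprime (snd (quotient_of r)) (int p)"

text \<open>
  The embedding \<open>\<rat> \<inter> \<int>\<^sub>p \<rightarrow> \<int>\<^sub>p\<close>; it is meaningful only for \<open>p\<close>-integral arguments.
\<close>

definition padic_of_rat :: "nat \<Rightarrow> rat \<Rightarrow> padic" where
  "padic_of_rat p r = (\<lambda>n. case quotient_of r of (a, b) \<Rightarrow>
     (a * modular_inverse (int p ^ n) b) mod int p ^ n)"

text \<open>\<open>a \<equiv> b (mod p\<^sup>k)\<close>, i.e. \<open>a - b \<in> p\<^sup>k\<int>\<^sub>p\<close>.\<close>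

definition padic_cong :: "nat \<Rightarrow> nat \<Rightarrow> padic \<Rightarrow> padic \<Rightarrow> bool" where
  "padic_cong p k a b \<longleftrightarrow>
     a \<in> carrier (padic_ints p) \<and> b \<in> carrier (padic_ints p) \<and>
     a \<ominus>\<^bsub>padic_ints p\<^esub> b \<in> PIdl\<^bsub>padic_ints p\<^esub> (padic_of_rat p (of_nat p ^ k))"

lemma padic_intsD:
  assumes "x \<in> carrier (padic_ints p)"
  shows "0 \<le> x n" "x n < int p ^ n" "x (Suc n) mod int p ^ n = x n" "x n mod int p ^ n = x n"
  using assms by (auto simp: padic_ints_def)

lemma cring_padic_ints:
  assumes "p > 0"
  shows "cring (padic_ints p)"
proof (rule cringI)
  let ?Z = "padic_ints p"
  have closed: "(\<lambda>n. f n mod int p ^ n) \<in> carrier ?Z"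
    if "\<And>n. f (Suc n) mod int p ^ n = f n mod int p ^ n" for f
    using that assms by (auto simp: padic_ints_def mod_mod_cancel)
  have add_closed: "x \<oplus>\<^bsub>?Z\<^esub> y \<in> carrier ?Z" if "x \<in> carrier ?Z" "y \<in> carrier ?Z" for x y
    using closed[of "\<lambda>n. x n + y n"] padic_intsD(3)[OF that(1)] padic_intsD(3)[OF that(2)]
    by (simp add: padic_ints_def) (metis mod_add_eq)
  have mult_closed: "x \<otimes>\<^bsub>?Z\<^esub> y \<in> carrier ?Z" if "x \<in> carrier ?Z" "y \<in> carrier ?Z" for x y
    using closed[of "\<lambda>n. x n * y n"] padic_intsD(3)[OF that(1)] padic_intsD(3)[OF that(2)]
    by (simp add: padic_ints_def) (metis mod_mult_eq)
  show "abelian_group ?Z"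
  proof (rule abelian_groupI)
    fix x assume x: "x \<in> carrier ?Z"
    show "\<exists>y\<in>carrier ?Z. y \<oplus>\<^bsub>?Z\<^esub> x = \<zero>\<^bsub>?Z\<^esub>"
    proof
      show "(\<lambda>n. (- x n) mod int p ^ n) \<in> carrier ?Z"
        by (rule closed) (metis mod_minus_eq padic_intsD(3)[OF x])
      show "(\<lambda>n. (- x n) mod int p ^ n) \<oplus>\<^bsub>?Z\<^esub> x = \<zero>\<^bsub>?Z\<^esub>"
        by (simp add: padic_ints_def mod_simps)
    qed
    show "\<zero>\<^bsub>?Z\<^esub> \<oplus>\<^bsub>?Z\<^esub> x = x"
      using padic_intsD(4)[OF x] by (simp add: padic_ints_def)
  next
    show "\<zero>\<^bsub>?Z\<^esub> \<in> carrier ?Z"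
      using assms by (simp add: padic_ints_def)
  qed (rule add_closed; assumption | simp add: padic_ints_def mod_simps ac_simps)+
  show "comm_monoid ?Z"
  proof (rule comm_monoidI)
    show "\<one>\<^bsub>?Z\<^esub> \<in> carrier ?Z"
      using closed[of "\<lambda>n. 1"] by (simp add: padic_ints_def)
  next
    fix x assume x: "x \<in> carrier ?Z"
    show "\<one>\<^bsub>?Z\<^esub> \<otimes>\<^bsub>?Z\<^esub> x = x"
      using padic_intsD(4)[OF x] by (simp add: padic_ints_def mod_simps)
  qed (rule mult_closed; assumption | simp add: padic_ints_def mod_simps ac_simps)+
qed (auto simp: padic_ints_def mod_simps algebra_simps)

lemma padic_of_rat_cong:
  assumes "p_integral p r" "quotient_of r = (a, b)"
  shows "[b * padic_of_rat p r n = a] (mod int p ^ n)"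
proof -
  have "coprime b (int p ^ n)"
    using assms by (simp add: p_integral_def)
  then have "[a * (b * modular_inverse (int p ^ n) b) = a * 1] (mod int p ^ n)"
    by (intro cong_mult cong_refl cong_modular_inverse1)
  then show ?thesis
    using assms by (simp add: padic_of_rat_def cong_def mod_simps ac_simps)
qed

lemma padic_of_rat_closed:
  assumes "p > 0" "p_integral p r"
  shows "padic_of_rat p r \<in> carrier (padic_ints p)"
proof -
  obtain a b where q: "quotient_of r = (a, b)" by fastforce
  have "padic_of_rat p r (Suc n) mod int p ^ n = padic_of_rat p r n" for n
  proof -
    have "[b * padic_of_rat p r (Suc n) = b * padic_of_rat p r n] (mod int p ^ n)"
      using padic_of_rat_cong[OF assms(2) q, of n] padic_of_rat_cong[OF assms(2) q, of "Suc n"]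
      by (meson cong_dvd_modulus cong_sym cong_trans le_imp_power_dvd lessI less_imp_le)
    moreover have "coprime b (int p ^ n)"
      using assms q by (simp add: p_integral_def)
    ultimately have "[padic_of_rat p r (Suc n) = padic_of_rat p r n] (mod int p ^ n)"
      by (simp add: cong_mult_lcancel)
    then show ?thesis
      by (simp add: cong_def padic_of_rat_def split: prod.splits)
  qed
  then show ?thesis
    using assms by (auto simp: padic_ints_def padic_of_rat_def q)
qed

section \<open>Wilson quotients and divided Bernoulli numbers\<close>

text \<open>The division is exact for prime \<open>p\<close>, by Wilson's theorem.\<close>

definition wilson_quotient :: "nat \<Rightarrow> int" where
  "wilson_quotient p = (fact (p - 1) + 1) div int p"

definition bernoulli :: "nat \<Rightarrow> rat" where
  "bernoulli n = fact n * fps_nth (fps_X / (fps_exp 1 - 1)) n"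

definition divided_bernoulli :: "nat \<Rightarrow> nat \<Rightarrow> rat" where
  "divided_bernoulli p n =
     (bernoulli (n * (p - 1)) + 1 / of_nat p - 1) / of_nat (n * (p - 1))"

definition divided_bernoulli_shifted :: "nat \<Rightarrow> nat \<Rightarrow> nat \<Rightarrow> rat" where
  "divided_bernoulli_shifted p n d =
     bernoulli (n * (p - 1) - d) / of_nat (n * (p - 1) - d)"

end

theory Submission
  imports Defs "HOL-Number_Theory.Residues"
begin

text \<open>
  The proof computes a \<open>p\<close>-adic logarithm of \<open>- (p - 1)!\<close> and exponentiates it. Let \<open>W\<close> be the Wilson
  quotient, so that \<open>(p - 1)! = - (1 - p W)\<close>, and write \<open>a\<^bsup>p-1\<^esup> = 1 + p q\<^sub>a\<close> with the Fermat quotient \<open>q\<^sub>a\<close>.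
  Multiplying over \<open>0 < a < p\<close> gives \<open>(1 - p W)\<^bsup>p-1\<^esup> = \<Prod>a. (1 + p q\<^sub>a)\<close>. Hence \<open>1 - p W\<close> is the
  exponential of \<open>L = 1/(p - 1) \<cdot> \<Sum>a. log (1 + p q\<^sub>a)\<close>. Modulo \<open>p\<^sup>7\<close> both series may be cut off after
  degree \<open>6\<close>, which replaces analysis by polynomial identities (\<open>wilson_exp_log\<close>).

  The logarithm is expressed by Bernoulli numbers through the power sums
  \<open>S(j) = \<Sum>a. a\<^bsup>j(p-1)\<^esup> = \<Sum>a. (1 + p q\<^sub>a)\<^sup>j\<close>. As a function of \<open>j\<close> the sum \<open>S(j)\<close> has derivative
  \<open>(p - 1) L\<close> at \<open>j = 0\<close>; on the other hand, Faulhaber's formula modulo \<open>p\<^sup>7\<close> expresses \<open>S(j)\<close> by the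
  Bernoulli numbers of index \<open>n\<close>, \<open>n - 2\<close> and \<open>n - 4\<close> for \<open>n = j (p - 1)\<close>. The divided Bernoulli numbers
  satisfy Kummer congruences, which say that modulo \<open>p\<^sup>K\<close> they are values of a polynomial with \<open>p\<close>-integral
  coefficients at the points \<open>p \<cdot> j\<close>. So they may be extrapolated to \<open>j = 0\<close>. If \<open>x\<close>, \<open>y\<close>, \<open>z\<close> are
  the values at \<open>j = 0\<close> of the three families, the outcome is
  \<open>L = p x + p\<^sup>3 y / 3 + p\<^sup>5 z / 5\<close> (\<open>interpolates_divided_bernoulli\<close>).

  The Kummer congruences for the indices \<open>n - 2\<close> and \<open>n - 4\<close> come from an explicit formula for
  \<open>(2\<^sup>n - 1) B\<^sub>n / n\<close> as a combination of powers \<open>m\<^bsup>n-1\<^esup>\<close> with fixed \<open>p\<close>-integral weights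
  (\<open>bernoulli_power_sum\<close>). Those for the indices \<open>n\<close> follow from Faulhaber's formula,
  because \<open>S(j)\<close> itself is a polynomial in \<open>p \<cdot> j\<close> up to high powers of \<open>p\<close>.

  Expanding \<open>1 - exp L\<close> by powers of \<open>p\<close> gives polynomials in \<open>x\<close>, \<open>y\<close>, \<open>z\<close> as coefficients. The
  combinations of divided Bernoulli numbers in the theorem are extrapolation formulas for exactly these
  polynomials: each agrees with its polynomial at \<open>j = 0\<close> modulo the power of \<open>p\<close> to which it is needed
  (\<open>linear_coefficient\<close> to \<open>sextic_coefficient\<close>).
\<close>

section \<open>The local ring of \<open>p\<close>-integral rationals\<close>

lemma p_integralI:
  assumes "coprime b (int p)" shows "p_integral p (of_int a / of_int b)"
proof -
  obtain c d where q: "quotient_of (of_int a / of_int b) = (c, d)" by fastforce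
  have d: "d > 0" "coprime c d" "(of_int a / of_int b :: rat) = of_int c / of_int d"
    using quotient_of_denom_pos[OF q] quotient_of_coprime[OF q] quotient_of_div[OF q] by auto
  have "d dvd b"
  proof (cases "b = 0")
    case False
    then have "of_int (a * d) = (of_int (c * b) :: rat)"
      using d by (simp add: field_simps)
    then have "d dvd c * b" by (metis dvd_triv_right of_int_eq_iff)
    then show ?thesis using d(2) by (simp add: coprime_commute coprime_dvd_mult_right_iff)
  qed simp
  then show ?thesis using assms q coprime_divisors[of d b "int p" "int p"]
    by (simp add: p_integral_def)
qed

lemma p_integralE:
  assumes "p_integral p r"
  obtains a b where "b \<noteq> 0" "coprime b (int p)" "r = of_int a / of_int b"
proof -
  obtain a b where q: "quotient_of r = (a, b)" by fastforce
  then show ?thesis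
    using that[of b a] quotient_of_div[OF q] quotient_of_denom_pos[OF q] assms
    by (simp add: p_integral_def)
qed

lemma p_integral_of_int [simp, intro]: "p_integral p (of_int a)"
  using p_integralI[of 1 p a] by simp

lemma p_integral_of_nat [simp, intro]: "p_integral p (of_nat a)"
  using p_integral_of_int[of p "int a"] by simp

lemma p_integral_numeral [simp, intro]: "p_integral p 0" "p_integral p 1" "p_integral p (numeral k)"
  using p_integral_of_int[of p 0] p_integral_of_int[of p 1] p_integral_of_int[of p "numeral k"]
  by simp_all

lemma p_integral_add [intro]:
  assumes "p_integral p r" "p_integral p s" shows "p_integral p (r + s)"
proof -
  from assms obtain a b c d where "b \<noteq> 0" "coprime b (int p)" "r = of_int a / of_int b"
     "d \<noteq> 0" "coprime d (int p)" "s = of_int c / of_int d"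
    by (metis p_integralE)
  then show ?thesis using p_integralI[of "b * d" p "a * d + c * b"]
    by (simp add: add_divide_distrib)
qed

lemma p_integral_mult [intro]:
  assumes "p_integral p r" "p_integral p s" shows "p_integral p (r * s)"
proof -
  from assms obtain a b c d where "b \<noteq> 0" "coprime b (int p)" "r = of_int a / of_int b"
     "d \<noteq> 0" "coprime d (int p)" "s = of_int c / of_int d"
    by (metis p_integralE)
  then show ?thesis using p_integralI[of "b * d" p "a * c"] by simp
qed

lemma p_integral_uminus [intro]: "p_integral p r \<Longrightarrow> p_integral p (- r)"
  using p_integral_mult[of p "of_int (-1)" r] p_integral_of_int[of p "-1"] by simp

lemma p_integral_diff [intro]: "p_integral p r \<Longrightarrow> p_integral p s \<Longrightarrow> p_integral p (r - s)"
  using p_integral_add[of p r "- s"] by auto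

lemma p_integral_power [intro]: "p_integral p r \<Longrightarrow> p_integral p (r ^ n)"
  by (induction n) auto

lemma p_integral_sum [intro]: "(\<And>i. i \<in> A \<Longrightarrow> p_integral p (f i)) \<Longrightarrow> p_integral p (sum f A)"
  by (induction A rule: infinite_finite_induct) auto

lemma p_integral_prod [intro]: "(\<And>i. i \<in> A \<Longrightarrow> p_integral p (f i)) \<Longrightarrow> p_integral p (prod f A)"
  by (induction A rule: infinite_finite_induct) auto

lemma p_integral_inverse_int: "coprime b (int p) \<Longrightarrow> p_integral p (1 / of_int b)"
  using p_integralI[of b p 1] by simp

locale prime_ge_11 =
  fixes p :: nat
  assumes prime_p: "prime p" and p_ge: "p \<ge> 11"
begin

abbreviation P :: rat where "P \<equiv> of_nat p"

abbreviation integral :: "rat \<Rightarrow> bool" where "integral \<equiv> p_integral p"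

text \<open>
  Congruence modulo \<open>p\<^sup>k\<close> in the local ring, formulated for all rationals so that
  multiplication by a power of \<open>p\<close> is an exact shift of the modulus.
\<close>

definition qcong :: "nat \<Rightarrow> rat \<Rightarrow> rat \<Rightarrow> bool" where
  "qcong k a b \<longleftrightarrow> integral ((a - b) / P ^ k)"

lemma p_pos [simp]: "p > 0" "p \<noteq> 0"
  using p_ge by auto

lemma integral_divide_nat:
  assumes "integral r" "\<not> p dvd m" shows "integral (r / of_nat m)"
proof -
  have "coprime (int m) (int p)"
    using prime_imp_coprime[OF prime_p assms(2)] by (simp add: coprime_commute)
  from p_integral_mult[OF assms(1) p_integral_inverse_int[OF this]] show ?thesis by simp
qed

lemma integral_divide_small:
  assumes "integral r" "0 < m" "m < p" shows "integral (r / of_nat m)"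
  using integral_divide_nat[OF assms(1), of m] assms by (auto dest: nat_dvd_not_less)

text \<open>
  Here \<open>3628800 = 10!\<close>, which is prime to \<open>p\<close> because \<open>p > 10\<close>. The side condition is a divisibility of
  numerals, which the simplifier decides.
\<close>

lemma integral_divide_numeral:
  assumes "integral r" "(numeral k :: nat) dvd 3628800" shows "integral (r / numeral k)"
proof -
  have "\<not> p dvd fact 10" using prime_dvd_fact_iff[OF prime_p, of 10] p_ge by simp
  moreover have "(fact 10 :: nat) = 3628800" by (simp add: fact_numeral)
  ultimately have "\<not> p dvd numeral k" using assms(2) dvd_trans by metis
  from integral_divide_nat[OF assms(1) this] show ?thesis by simp
qed

lemmas integral_intros = p_integral_add p_integral_diff p_integral_mult p_integral_uminus
  p_integral_power p_integral_sum p_integral_prod p_integral_numeral p_integral_of_nat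
  p_integral_of_int integral_divide_numeral

lemma qcong_refl [simp, intro]: "qcong k a a"
  by (simp add: qcong_def)

lemma qcong_sym: "qcong k a b \<Longrightarrow> qcong k b a"
  unfolding qcong_def using p_integral_uminus[of p "(a - b) / P ^ k"]
  by (simp add: minus_divide_left)

lemma qcong_trans [trans]: "qcong k a b \<Longrightarrow> qcong k b c \<Longrightarrow> qcong k a c"
  unfolding qcong_def using p_integral_add[of p "(a - b) / P ^ k" "(b - c) / P ^ k"]
  by (simp add: add_divide_distrib[symmetric])

lemma qcong_iff: "qcong k a b \<longleftrightarrow> (\<exists>r. integral r \<and> a = b + P ^ k * r)"
proof
  assume "qcong k a b" then show "\<exists>r. integral r \<and> a = b + P ^ k * r"
    by (intro exI[of _ "(a - b) / P ^ k"]) (auto simp: qcong_def)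
qed (auto simp: qcong_def)

lemma qcongI: "a = b + P ^ k * r \<Longrightarrow> integral r \<Longrightarrow> qcong k a b"
  by (auto simp: qcong_iff)

lemma qcong_add: "qcong k a b \<Longrightarrow> qcong k c d \<Longrightarrow> qcong k (a + c) (b + d)"
  unfolding qcong_def using p_integral_add[of p "(a - b) / P ^ k" "(c - d) / P ^ k"]
  by (simp add: add_divide_distrib[symmetric] algebra_simps)

lemma qcong_uminus: "qcong k a b \<Longrightarrow> qcong k (- a) (- b)"
  unfolding qcong_def using p_integral_uminus[of p "(a - b) / P ^ k"] by (simp add: minus_divide_left)

lemma qcong_diff: "qcong k a b \<Longrightarrow> qcong k c d \<Longrightarrow> qcong k (a - c) (b - d)"
  using qcong_add[of k a b "- c" "- d"] qcong_uminus by simp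

lemma qcong_mult:
  assumes "qcong k a b" "qcong k c d" "integral b" "integral c"
  shows "qcong k (a * c) (b * d)"
proof -
  from assms obtain r s where "integral r" "a = b + P ^ k * r" "integral s" "c = d + P ^ k * s"
    unfolding qcong_iff by blast
  then have "a * c = b * d + P ^ k * (r * c + b * s)" by (simp add: algebra_simps)
  moreover have "integral (r * c + b * s)" using assms(3,4) \<open>integral r\<close> \<open>integral s\<close> by auto
  ultimately show ?thesis by (rule qcongI)
qed

lemma qcong_integral: "qcong k a b \<Longrightarrow> integral b \<Longrightarrow> integral a"
  unfolding qcong_iff by auto

lemma qcong_cmult: "qcong k a b \<Longrightarrow> integral c \<Longrightarrow> qcong k (c * a) (c * b)"
  unfolding qcong_def using p_integral_mult[of p c "(a - b) / P ^ k"]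
  by (simp add: right_diff_distrib)

lemma qcong_power: "qcong k a b \<Longrightarrow> integral b \<Longrightarrow> qcong k (a ^ n) (b ^ n)"
  by (induction n) (auto intro!: qcong_mult dest: qcong_integral)

lemma qcong_sum: "(\<And>i. i \<in> A \<Longrightarrow> qcong k (f i) (g i)) \<Longrightarrow> qcong k (sum f A) (sum g A)"
  by (induction A rule: infinite_finite_induct) (auto intro: qcong_add)

lemma qcong_prod:
  "(\<And>i. i \<in> A \<Longrightarrow> qcong k (f i) (g i)) \<Longrightarrow> (\<And>i. i \<in> A \<Longrightarrow> integral (g i)) \<Longrightarrow> qcong k (prod f A) (prod g A)"
proof (induction A rule: infinite_finite_induct)
  case (insert x A)
  then have "integral (prod f A)"
    by (intro p_integral_prod) (blast intro: qcong_integral)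
  with insert show ?case by (auto intro!: qcong_mult)
qed auto

lemma qcong_mono:
  assumes "qcong k a b" "l \<le> k" shows "qcong l a b"
proof -
  from assms(1) obtain r where r: "integral r" "a = b + P ^ k * r" unfolding qcong_iff by blast
  have "P ^ k = P ^ l * P ^ (k - l)" using assms(2) by (simp add: power_add[symmetric])
  with r show ?thesis by (intro qcongI[where r = "P ^ (k - l) * r"]) auto
qed

lemma qcong_scale: "qcong (l + k) (P ^ l * a) (P ^ l * b) \<longleftrightarrow> qcong k a b"
proof -
  have "(P ^ l * a - P ^ l * b) / P ^ (l + k) = (a - b) / P ^ k"
    by (simp add: power_add right_diff_distrib[symmetric])
  then show ?thesis by (simp add: qcong_def)
qed

lemma integral_unit:
  assumes "integral x" "\<not> qcong 1 x 0" shows "integral (1 / x)"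
proof -
  from assms(1) obtain a b where ab: "b \<noteq> 0" "coprime b (int p)" "x = of_int a / of_int b"
    by (metis p_integralE)
  have "\<not> int p dvd a"
  proof
    assume "int p dvd a"
    then obtain c where "a = int p * c" by blast
    then have "x = 0 + P ^ 1 * (of_int c / of_int b)" using ab by simp
    moreover have "integral (of_int c / of_int b)" using ab p_integralI by blast
    ultimately show False using assms(2) qcongI by blast
  qed
  then have "coprime a (int p)"
    using prime_p prime_imp_coprime[of "int p" a] by (simp add: coprime_commute)
  from p_integral_mult[OF p_integral_inverse_int[OF this] p_integral_of_int[of p b]]
  show ?thesis using ab by simp
qed

text \<open>
  The usual source of units: an element congruent modulo \<open>p\<close> to an integer prime to \<open>p\<close>.
\<close>

lemma integral_near_one:
  assumes "integral x" "qcong 1 x (of_int a)" "\<not> int p dvd a" shows "integral (1 / x)" "x \<noteq> 0"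
proof -
  have "\<not> qcong 1 x 0"
  proof
    assume "qcong 1 x 0"
    with assms(2) have "qcong 1 (of_int a) 0" using qcong_sym qcong_trans by blast
    then obtain r where r: "integral r" "of_int a = P * r" by (auto simp: qcong_iff)
    from r(1) obtain c d where cd: "d \<noteq> 0" "coprime d (int p)" "r = of_int c / of_int d"
      by (metis p_integralE)
    have "of_int (a * d) = (of_int (int p * c) :: rat)" using r cd by (simp add: field_simps)
    then have "int p dvd a * d" by (metis dvd_triv_left of_int_eq_iff)
    then show False using assms(3) cd(2)
      by (simp add: coprime_commute coprime_dvd_mult_left_iff)
  qed
  then show "integral (1 / x)" "x \<noteq> 0" using integral_unit[OF assms(1)] by auto
qed


section \<open>Extrapolating to index zero\<close>

definition integral_poly :: "rat poly \<Rightarrow> bool" where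
  "integral_poly g \<longleftrightarrow> (\<forall>i. integral (Polynomial.coeff g i))"

lemma integral_poly_pCons: "integral c \<Longrightarrow> integral_poly g \<Longrightarrow> integral_poly (pCons c g)"
  by (auto simp: integral_poly_def coeff_pCons split: nat.splits)

lemma integral_poly_0: "integral_poly 0"
  by (simp add: integral_poly_def)

lemma integral_poly_add: "integral_poly f \<Longrightarrow> integral_poly g \<Longrightarrow> integral_poly (f + g)"
  by (auto simp: integral_poly_def)

lemma integral_poly_mult: "integral_poly f \<Longrightarrow> integral_poly g \<Longrightarrow> integral_poly (f * g)"
  by (auto simp: integral_poly_def coeff_mult intro!: p_integral_sum)

lemma integral_poly_pcompose:
  assumes "integral_poly f" "integral_poly g" shows "integral_poly (pcompose f g)"
  using assms(1)
proof (induction f)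
  case (pCons a f)
  then have "integral a" "integral_poly f"
    by (auto simp: integral_poly_def coeff_pCons split: nat.splits)
  with pCons show ?case
    by (auto simp: pcompose_pCons intro!: integral_poly_add integral_poly_mult integral_poly_pCons
        integral_poly_0 assms(2))
qed (simp add: integral_poly_0)

lemma integral_poly_value:
  assumes "integral_poly g" "integral x" shows "integral (poly g x)"
  unfolding poly_altdef using assms by (auto simp: integral_poly_def)

text \<open>
  The variable carries a factor \<open>p\<close>, so a monomial of degree \<open>i\<close> is divisible by \<open>p\<^sup>i\<close>: modulo
  \<open>p\<^sup>K\<close> only the coefficients below degree \<open>K\<close> matter.
\<close>

lemma poly_truncate:
  assumes g: "integral_poly g" and t: "integral t"
  shows "qcong K (poly g (P * t)) (\<Sum>i<K. Polynomial.coeff g i * P ^ i * t ^ i)"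
proof -
  let ?N = "K + degree g"
  have "poly g (P * t) = (\<Sum>i\<le>?N. Polynomial.coeff g i * (P * t) ^ i)"
    unfolding poly_altdef
    by (intro sum.mono_neutral_left) (auto simp: coeff_eq_0)
  also have "\<dots> = (\<Sum>i<K. Polynomial.coeff g i * (P * t) ^ i) + (\<Sum>i=K..?N. Polynomial.coeff g i * (P * t) ^ i)"
  proof -
    have "{..?N} = {..<K} \<union> {K..?N}" by auto
    then show ?thesis by (simp only:) (rule sum.union_disjoint; auto)
  qed
  also have "(\<Sum>i=K..?N. Polynomial.coeff g i * (P * t) ^ i)
      = P ^ K * (\<Sum>i=K..?N. Polynomial.coeff g i * P ^ (i - K) * t ^ i)"
    unfolding sum_distrib_left
  proof (intro sum.cong refl)
    fix i assume "i \<in> {K..?N}"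
    then have "P ^ i = P ^ K * P ^ (i - K)" by (simp add: power_add[symmetric])
    then show "Polynomial.coeff g i * (P * t) ^ i = P ^ K * (Polynomial.coeff g i * P ^ (i - K) * t ^ i)"
      by (simp add: power_mult_distrib mult_ac)
  qed
  also have "(\<Sum>i<K. Polynomial.coeff g i * (P * t) ^ i) = (\<Sum>i<K. Polynomial.coeff g i * P ^ i * t ^ i)"
    by (simp add: power_mult_distrib mult_ac)
  finally show ?thesis
    using g t unfolding integral_poly_def
    by (elim qcongI) (intro p_integral_sum p_integral_mult p_integral_power; simp)
qed

text \<open>
  The form in which Kummer congruences are used. The values \<open>f 1, \<dots>, f 6\<close> come from a function of
  \<open>p \<cdot> j\<close> that is a polynomial with \<open>p\<close>-integral coefficients modulo \<open>p\<^sup>K\<close>. Equivalently, the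
  \<open>r\<close>-th differences formed from these values are divisible by \<open>p\<^sup>r\<close> for \<open>r \<le> K\<close>. The third argument is the value of such a
  polynomial at the index \<open>j = 0\<close>, where the divided Bernoulli numbers themselves are not defined.
  Unlike divisibility of differences, this property is visibly stable under products.
\<close>

definition interpolates :: "nat \<Rightarrow> (nat \<Rightarrow> rat) \<Rightarrow> rat \<Rightarrow> bool" where
  "interpolates K f v \<longleftrightarrow> (\<exists>g. integral_poly g \<and> poly g 0 = v \<and>
     (\<forall>j\<in>{1..6}. qcong K (f j) (poly g (P * of_nat j))))"

lemma interpolatesE:
  assumes "interpolates K f v"
  obtains g where "integral_poly g" "poly g 0 = v"
    "\<And>j. j \<in> {1..6} \<Longrightarrow> qcong K (f j) (poly g (P * of_nat j))"
    "\<And>j. integral (poly g (P * of_nat j))"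
proof -
  from assms obtain g where g: "integral_poly g" "poly g 0 = v"
    "\<forall>j\<in>{1..6}. qcong K (f j) (poly g (P * of_nat j))" unfolding interpolates_def by blast
  moreover have "integral (poly g (P * of_nat j))" for j
    using g(1) by (intro integral_poly_value) auto
  ultimately show ?thesis using that by blast
qed

lemma interpolates_cong:
  assumes "interpolates K f v" "\<And>j. j \<in> {1..6} \<Longrightarrow> qcong K (h j) (f j)"
  shows "interpolates K h v"
  using assms qcong_trans unfolding interpolates_def by blast

lemma interpolates_mono:
  assumes "interpolates K f v" "l \<le> K" shows "interpolates l f v"
  using assms qcong_mono unfolding interpolates_def by blast

lemma interpolates_integral:
  assumes "interpolates K f v" "j \<in> {1..6}" shows "integral (f j)"
  using assms by (elim interpolatesE) (blast intro: qcong_integral)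

lemma interpolates_const: "integral c \<Longrightarrow> interpolates K (\<lambda>j. c) c"
  unfolding interpolates_def
  by (rule exI[of _ "[:c:]"]) (auto intro: integral_poly_pCons integral_poly_0)

lemma interpolates_id: "interpolates K (\<lambda>j. P * of_nat j) 0"
  unfolding interpolates_def
  by (rule exI[of _ "[:0, 1:]"]) (auto intro: integral_poly_pCons integral_poly_0)

lemma interpolates_add:
  assumes "interpolates K f v" "interpolates K h w"
  shows "interpolates K (\<lambda>j. f j + h j) (v + w)"
proof -
  from assms(1) obtain a where "integral_poly a" "poly a 0 = v"
    "\<And>j. j \<in> {1..6} \<Longrightarrow> qcong K (f j) (poly a (P * of_nat j))" by (elim interpolatesE) blast
  moreover from assms(2) obtain b where "integral_poly b" "poly b 0 = w"
    "\<And>j. j \<in> {1..6} \<Longrightarrow> qcong K (h j) (poly b (P * of_nat j))" by (elim interpolatesE) blast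
  ultimately show ?thesis
    unfolding interpolates_def
    by (intro exI[of _ "a + b"]) (auto intro: integral_poly_add qcong_add)
qed

lemma interpolates_mult:
  assumes "interpolates K f v" "interpolates K h w"
  shows "interpolates K (\<lambda>j. f j * h j) (v * w)"
proof -
  from assms(1) obtain a where a: "integral_poly a" "poly a 0 = v"
    "\<And>j. j \<in> {1..6} \<Longrightarrow> qcong K (f j) (poly a (P * of_nat j))"
    "\<And>j. integral (poly a (P * of_nat j))" by (elim interpolatesE) blast
  from assms(2) obtain b where b: "integral_poly b" "poly b 0 = w"
    "\<And>j. j \<in> {1..6} \<Longrightarrow> qcong K (h j) (poly b (P * of_nat j))" by (elim interpolatesE) blast
  show ?thesis
    unfolding interpolates_def
    by (intro exI[of _ "a * b"])
       (auto simp: a(2) b(2) intro!: integral_poly_mult a b qcong_mult interpolates_integral[OF assms(2)])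
qed

lemma interpolates_cmult:
  "interpolates K f v \<Longrightarrow> integral c \<Longrightarrow> interpolates K (\<lambda>j. c * f j) (c * v)"
  by (intro interpolates_mult interpolates_const)

lemma interpolates_diff:
  assumes "interpolates K f v" "interpolates K h w"
  shows "interpolates K (\<lambda>j. f j - h j) (v - w)"
  using interpolates_add[OF assms(1) interpolates_cmult[OF assms(2), of "- 1"]] by auto

lemma interpolates_sum:
  assumes "\<And>i. i \<in> A \<Longrightarrow> interpolates K (f i) (v i)"
  shows "interpolates K (\<lambda>j. \<Sum>i\<in>A. f i j) (\<Sum>i\<in>A. v i)"
  using assms
  by (induction A rule: infinite_finite_induct) (auto intro!: interpolates_add interpolates_const)

lemma interpolates_prod:
  assumes "\<And>i. i \<in> A \<Longrightarrow> interpolates K (f i) (v i)"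
  shows "interpolates K (\<lambda>j. \<Prod>i\<in>A. f i j) (\<Prod>i\<in>A. v i)"
  using assms
  by (induction A rule: infinite_finite_induct) (auto intro!: interpolates_mult interpolates_const)

lemma interpolates_power:
  assumes "interpolates K f v" shows "interpolates K (\<lambda>j. f j ^ n) (v ^ n)"
  by (induction n) (auto intro!: interpolates_mult assms interpolates_const)

text \<open>
  A function that is \<open>1\<close> modulo \<open>p\<close> is inverted by the geometric series, cut off at degree \<open>K\<close>.
\<close>

lemma interpolates_inverse:
  assumes f: "interpolates K f v" and one: "\<And>j. j \<in> {1..6} \<Longrightarrow> qcong 1 (f j) 1"
  obtains w where "interpolates K (\<lambda>j. 1 / f j) w"
proof -
  have "interpolates K (\<lambda>j. \<Sum>i<K. (1 - f j) ^ i) (\<Sum>i<K. (1 - v) ^ i)"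
    using f by (intro interpolates_sum interpolates_power interpolates_diff interpolates_const) auto
  moreover have "qcong K (1 / f j) (\<Sum>i<K. (1 - f j) ^ i)" if j: "j \<in> {1..6}" for j
  proof -
    have fj: "integral (f j)" using f j by (rule interpolates_integral)
    have "qcong 1 (f j) (of_int 1)" "\<not> int p dvd 1" using one[OF j] p_ge by simp_all
    from integral_near_one[OF fj this] have inv: "integral (1 / f j)" and nz: "f j \<noteq> 0" .
    from qcong_sym[OF one[OF j]] obtain r where r: "integral r" "1 = f j + P * r"
      by (auto simp: qcong_iff)
    then have "1 - f j = P * r" by simp
    moreover have "f j * (\<Sum>i<K. (1 - f j) ^ i) = 1 - (1 - f j) ^ K"
      using one_diff_power_eq[of "1 - f j" K] by simp
    ultimately have "f j * (\<Sum>i<K. (1 - f j) ^ i) = 1 - P ^ K * r ^ K"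
      by (simp add: power_mult_distrib)
    then have "1 / f j = (\<Sum>i<K. (1 - f j) ^ i) + P ^ K * (r ^ K * (1 / f j))"
      using nz by (simp add: field_simps)
    then show ?thesis using r inv by (blast intro: qcongI)
  qed
  ultimately have "interpolates K (\<lambda>j. 1 / f j) (\<Sum>i<K. (1 - v) ^ i)"
    by (rule interpolates_cong)
  then show ?thesis by (rule that)
qed

lemma interpolates_expand:
  assumes "interpolates K f v" "K > 0"
  obtains x where "x 0 = v" "\<And>i. integral (x i)"
    "\<And>j. j \<in> {1..6} \<Longrightarrow> qcong K (f j) (\<Sum>i<K. x i * P ^ i * of_nat j ^ i)"
proof -
  from assms obtain g where g: "integral_poly g" "poly g 0 = v"
    "\<And>j. j \<in> {1..6} \<Longrightarrow> qcong K (f j) (poly g (P * of_nat j))" by (elim interpolatesE) blast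
  show ?thesis
  proof (rule that[of "Polynomial.coeff g"])
    show "Polynomial.coeff g 0 = v" using g(2) by (simp add: poly_0_coeff_0)
    show "integral (Polynomial.coeff g i)" for i using g(1) by (simp add: integral_poly_def)
    show "qcong K (f j) (\<Sum>i<K. Polynomial.coeff g i * P ^ i * of_nat j ^ i)" if "j \<in> {1..6}" for j
      using qcong_trans[OF g(3)[OF that] poly_truncate[OF g(1)]] by simp
  qed
qed

text \<open>
  The product \<open>p\<^sup>i \<cdot> C(j - 1, i)\<close> is a polynomial in \<open>p \<cdot> j\<close>, because each of the \<open>i\<close> linear factors absorbs one
  power of \<open>p\<close>; at \<open>j = 0\<close> the binomial coefficient becomes \<open>C(-1, i) = (-1)\<^sup>i\<close>.
\<close>

lemma interpolates_binomial:
  assumes "i < p"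
  shows "interpolates K (\<lambda>j. P ^ i * of_nat ((j - 1) choose i)) ((- P) ^ i)"
proof -
  have "\<not> p dvd fact i" using prime_dvd_fact_iff[OF prime_p] assms by simp
  then have fi: "integral (1 / fact i)"
    using integral_divide_nat[of 1 "fact i"] by simp
  have fac: "interpolates K (\<lambda>j. P * of_nat j - P * of_nat (l + 1)) (0 - P * of_nat (l + 1))" for l
    by (intro interpolates_diff interpolates_id interpolates_const) auto
  have "interpolates K (\<lambda>j. 1 / fact i * (\<Prod>l<i. P * of_nat j - P * of_nat (l + 1)))
      (1 / fact i * (\<Prod>l<i. 0 - P * of_nat (l + 1)))"
    by (intro interpolates_cmult interpolates_prod fac fi)
  moreover have "1 / fact i * (\<Prod>l<i. 0 - P * of_nat (l + 1)) = (- P) ^ i"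
  proof -
    have "(\<Prod>l<i. 0 - P * of_nat (l + 1)) = (\<Prod>l<i. (- P) * of_nat (l + 1))"
      by (intro prod.cong) auto
    also have "\<dots> = (- P) ^ i * of_nat (\<Prod>l<i. l + 1)"
      by (subst prod.distrib) simp
    also have "(\<Prod>l<i. l + 1) = fact i"
      by (simp add: fact_prod_Suc lessThan_atLeast0)
    finally show ?thesis by simp
  qed
  moreover have "P ^ i * of_nat ((j - 1) choose i)
      = 1 / fact i * (\<Prod>l<i. P * of_nat j - P * of_nat (l + 1))" if "j \<in> {1..6}" for j
  proof -
    have "(of_nat ((j - 1) choose i) :: rat) = (\<Prod>l<i. of_nat (j - 1) - of_nat l) / fact i"
      by (simp add: binomial_gbinomial gbinomial_prod_rev lessThan_atLeast0)
    moreover have "(\<Prod>l<i. P * of_nat j - P * of_nat (l + 1))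
        = (\<Prod>l<i. P * (of_nat (j - 1) - of_nat l))"
      using that by (intro prod.cong) (auto simp: algebra_simps of_nat_diff)
    moreover have "\<dots> = P ^ i * (\<Prod>l<i. of_nat (j - 1) - of_nat l)"
      by (subst prod.distrib) simp
    ultimately show ?thesis by simp
  qed
  ultimately show ?thesis by (auto elim!: interpolates_cong)
qed

text \<open>
  Powers of a principal unit: the binomial series in the exponent.
\<close>

lemma interpolates_one_unit_power:
  assumes "integral q"
  obtains v where "interpolates K (\<lambda>j. (1 + P * q) ^ (j - 1)) v"
proof -
  have "interpolates K (\<lambda>j. \<Sum>i<6. q ^ i * (P ^ i * of_nat ((j - 1) choose i)))
      (\<Sum>i<6. q ^ i * (- P) ^ i)"
    using p_ge assms by (intro interpolates_sum interpolates_cmult interpolates_binomial) auto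
  moreover have "(1 + P * q) ^ (j - 1) = (\<Sum>i<6. q ^ i * (P ^ i * of_nat ((j - 1) choose i)))"
    if "j \<in> {1..6}" for j
  proof -
    have "(1 + P * q) ^ (j - 1) = (\<Sum>i\<le>j - 1. of_nat ((j - 1) choose i) * (P * q) ^ i)"
      using binomial_ring[of "P * q" 1 "j - 1"] by (simp add: add.commute)
    also have "\<dots> = (\<Sum>i<6. of_nat ((j - 1) choose i) * (P * q) ^ i)"
      using that by (intro sum.mono_neutral_left) auto
    finally show ?thesis by (simp add: power_mult_distrib mult_ac)
  qed
  ultimately show ?thesis by (intro that) (auto elim!: interpolates_cong)
qed

end

section \<open>Generating functions of Bernoulli numbers\<close>

definition bernoulli_fps :: "rat fps" where
  "bernoulli_fps = fps_X / (fps_exp 1 - 1)"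

lemma fps_exp_minus_1_nz: "fps_exp (c::rat) - 1 \<noteq> 0" if "c \<noteq> 0"
proof
  assume "fps_exp c - 1 = 0"
  then have "fps_nth (fps_exp c - 1) 1 = 0" by simp
  then show False using that by simp
qed

lemma bernoulli_fps_mult: "bernoulli_fps * (fps_exp 1 - 1) = fps_X"
proof -
  have "subdegree (fps_exp (1::rat) - 1) \<le> 1" by (rule subdegree_leI) simp
  then have "(fps_exp (1::rat) - 1) dvd fps_X"
    using fps_exp_minus_1_nz[of 1] by (subst fps_dvd_iff) auto
  then show ?thesis by (simp add: bernoulli_fps_def)
qed

lemma bernoulli_nth: "bernoulli n = fact n * fps_nth bernoulli_fps n"
  by (simp add: bernoulli_def bernoulli_fps_def)

text \<open>
  The dilations by \<open>-1\<close> and \<open>2\<close> are needed: the first shows that odd Bernoulli numbers vanish, the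
  second brings in the factor \<open>2\<^sup>n - 1\<close>.
\<close>

lemma bernoulli_fps_dilate:
  "Abs_fps (\<lambda>n. c ^ n * fps_nth bernoulli_fps n) * (fps_exp c - 1) = fps_const c * fps_X"
proof -
  let ?s = "fps_const c * fps_X :: rat fps"
  have "(bernoulli_fps * (fps_exp 1 - 1)) oo ?s = fps_X oo ?s"
    by (simp only: bernoulli_fps_mult)
  moreover have "fps_nth ?s 0 = 0" by simp
  ultimately have "(bernoulli_fps oo ?s) * ((fps_exp 1 oo ?s) - 1) = ?s"
    by (simp add: fps_compose_mult_distrib fps_compose_sub_distrib)
  moreover have "fps_exp 1 oo ?s = fps_exp c" by (simp add: fps_exp_compose_linear)
  moreover have "bernoulli_fps oo ?s = Abs_fps (\<lambda>n. c ^ n * fps_nth bernoulli_fps n)"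
    by (rule fps_compose_linear)
  ultimately show ?thesis by simp
qed

text \<open>
  With \<open>F = t/(e\<^sup>t - 1)\<close> one has \<open>F(-t) = F(t) + t\<close>, so \<open>F\<close> is even up to its linear term.
\<close>

lemma bernoulli_odd_eq_0:
  assumes "odd n" "n > 1" shows "bernoulli n = 0"
proof -
  let ?G = "Abs_fps (\<lambda>n. (- 1) ^ n * fps_nth bernoulli_fps n)"
  have inv: "fps_exp (- 1) * fps_exp 1 = (1 :: rat fps)"
    by (simp add: fps_exp_add_mult[symmetric])
  have "?G * (1 - fps_exp 1) = ?G * (fps_exp (- 1) - 1) * fps_exp 1"
    by (simp add: left_diff_distrib right_diff_distrib mult.assoc inv)
  also have "\<dots> = - fps_X * fps_exp 1"
    by (simp only: bernoulli_fps_dilate[of "-1"]) (simp add: fps_const_neg[symmetric] del: fps_const_neg)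
  finally have "?G * (fps_exp 1 - 1) = fps_X * fps_exp 1" by (simp add: algebra_simps)
  moreover have "(?G - fps_X) * (fps_exp 1 - 1) = ?G * (fps_exp 1 - 1) - fps_X * fps_exp 1 + fps_X"
    by (simp only: left_diff_distrib right_diff_distrib) simp
  ultimately have "(?G - fps_X) * (fps_exp 1 - 1) = bernoulli_fps * (fps_exp 1 - 1)"
    by (simp add: bernoulli_fps_mult)
  then have "?G - fps_X = bernoulli_fps" using fps_exp_minus_1_nz[of 1] by simp
  then have "fps_nth (?G - fps_X) n = fps_nth bernoulli_fps n" by simp
  then show ?thesis using assms by (simp add: bernoulli_nth)
qed

text \<open>
  Faulhaber's formula, by comparing coefficients in
  \<open>\<Sum>a<N. e\<^bsup>at\<^esup> = t/(e\<^sup>t - 1) \<cdot> (e\<^bsup>Nt\<^esup> - 1)/t\<close>.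
\<close>

lemma sum_powers_bernoulli:
  "(\<Sum>a<N. of_nat a ^ n) =
    (\<Sum>k\<le>n. of_nat (n choose k) * bernoulli (n - k) * of_nat N ^ (k + 1) / of_nat (k + 1) :: rat)"
proof -
  define H :: "rat fps" where "H = Abs_fps (\<lambda>k. of_nat N ^ (k + 1) / fact (k + 1))"
  have geo: "(\<Sum>a<N. fps_exp (of_nat a)) * (fps_exp 1 - 1) = fps_exp (of_nat N :: rat) - 1"
    by (induction N) (simp_all add: distrib_right algebra_simps fps_exp_add_mult)
  have H: "fps_X * H = fps_exp (of_nat N) - 1"
  proof (rule fps_ext)
    show "fps_nth (fps_X * H) k = fps_nth (fps_exp (of_nat N) - 1) k" for k
      by (cases k) (simp_all add: H_def field_simps)
  qed
  have "(\<Sum>a<N. fps_exp (of_nat a)) * (fps_exp 1 - 1) = bernoulli_fps * H * (fps_exp 1 - 1)"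
    using geo H bernoulli_fps_mult by (metis mult.assoc mult.commute)
  then have "(\<Sum>a<N. fps_exp (of_nat a)) = bernoulli_fps * H"
    using fps_exp_minus_1_nz[of 1] by simp
  then have "fact n * fps_nth (\<Sum>a<N. fps_exp (of_nat a)) n = fact n * fps_nth (H * bernoulli_fps) n"
    by (simp add: mult.commute)
  moreover have "fact n * fps_nth (\<Sum>a<N. fps_exp (of_nat a :: rat)) n = (\<Sum>a<N. of_nat a ^ n)"
    by (simp add: fps_sum_nth sum_distrib_left)
  moreover have "fact n * fps_nth (H * bernoulli_fps) n =
      (\<Sum>k\<le>n. of_nat (n choose k) * bernoulli (n - k) * of_nat N ^ (k + 1) / of_nat (k + 1))"
    unfolding fps_mult_nth sum_distrib_left atLeast0AtMost
    by (intro sum.cong refl)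
       (simp add: H_def bernoulli_nth binomial_fact field_simps del: of_nat_Suc)
  ultimately show ?thesis by simp
qed

context prime_ge_11
begin

text \<open>
  The source of the Kummer congruences. Subtracting the generating function from its dilation by \<open>2\<close>
  gives \<open>2t/(e\<^bsup>2t\<^esup> - 1) - t/(e\<^sup>t - 1) = - t/(e\<^sup>t + 1)\<close>. In terms of \<open>u = e\<^sup>t - 1\<close> the quotient
  \<open>1/(e\<^sup>t + 1) = 1/(2 + u)\<close> is a power series in \<open>u\<close> whose coefficients have powers of \<open>2\<close> as
  denominators, and, up to the factor
  \<open>(n - 1)!\<close>, the coefficients of \<open>u\<^sup>i\<close> as a series in \<open>t\<close> are integral combinations of powers
  \<open>m\<^bsup>n-1\<^esup>\<close>. The point is that the weights \<open>w\<close> do not depend on \<open>n\<close>, so that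
  \<open>(2\<^sup>n - 1) B\<^sub>n / n\<close> inherits the \<open>p\<close>-adic behaviour of \<open>n \<mapsto> m\<^bsup>n-1\<^esup>\<close>.
\<close>

lemma bernoulli_power_sum:
  obtains w :: "nat \<Rightarrow> rat" where "\<And>m. integral (w m)"
    "\<And>n. n \<in> {1..N} \<Longrightarrow> (2 ^ n - 1) * (bernoulli n / of_nat n) = (\<Sum>m\<le>N. w m * of_nat m ^ (n - 1))"
proof -
  define u :: "rat fps" where "u = fps_exp 1 - 1"
  define H :: "rat fps" where "H = inverse (fps_exp 1 + 1)"
  have H: "H * (u + 2) = 1"
    using inverse_mult_eq_1[of "fps_exp (1::rat) + 1"] by (simp add: H_def u_def add.commute)
  define G where "G = Abs_fps (\<lambda>n. 2 ^ n * fps_nth bernoulli_fps n)"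
  have e2: "fps_exp (2::rat) = fps_exp 1 * fps_exp 1" by (simp add: fps_exp_add_mult[symmetric])
  have "G * (fps_exp 2 - 1) = 2 * fps_X"
    using bernoulli_fps_dilate[of 2] by (simp add: G_def numeral_fps_const)
  moreover have "(G - bernoulli_fps) * (u + 2) * u
      = G * (fps_exp 2 - 1) - bernoulli_fps * (fps_exp 1 - 1) * (u + 2)"
    by (simp add: e2 u_def algebra_simps)
  ultimately have "(G - bernoulli_fps) * (u + 2) * u = 2 * fps_X - fps_X * (u + 2)"
    by (simp add: bernoulli_fps_mult)
  then have "(G - bernoulli_fps) * (u + 2) * u = - fps_X * u" by (simp add: algebra_simps)
  moreover have "u \<noteq> 0" using fps_exp_minus_1_nz[of 1] by (simp add: u_def)
  ultimately have "(G - bernoulli_fps) * (u + 2) = - fps_X" by (metis mult_right_cancel)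
  then have "G - bernoulli_fps = - fps_X * H"
    using H by (metis mult.assoc mult.commute mult.left_neutral)
  then have GB_nth: "fps_nth (G - bernoulli_fps) n = fps_nth (- fps_X * H) n" for n by simp
  have GB: "(2 ^ n - 1) * fps_nth bernoulli_fps n = - fps_nth H (n - 1)" if "n \<ge> 1" for n
    using that GB_nth[of n] by (simp add: G_def algebra_simps)
  \<comment> \<open>the geometric series of \<open>1 / (2 + u)\<close>; its tail starts with \<open>u\<^bsup>N+1\<^esup>\<close>, which has no term below \<open>t\<^bsup>N+1\<^esup>\<close>\<close>
  define c :: "nat \<Rightarrow> rat" where "c i = (- 1) ^ i / 2 ^ (i + 1)" for i
  define S where "S = (\<Sum>i\<le>N. fps_const (c i) * u ^ i)"
  have S: "(u + 2) * S = 1 + fps_const (c N) * u ^ (N + 1)"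
    unfolding S_def
  proof (induction N)
    case 0
    have "fps_const (c 0) * 2 = (1 :: rat fps)"
      by (simp add: c_def numeral_fps_const)
    then show ?case by (simp add: algebra_simps)
  next
    case (Suc N)
    have double: "fps_const (c (Suc N)) * 2 = - fps_const (c N)"
      by (simp add: c_def numeral_fps_const)
    have split: "(u + 2) * (\<Sum>i\<le>Suc N. fps_const (c i) * u ^ i)
        = (u + 2) * (\<Sum>i\<le>N. fps_const (c i) * u ^ i)
          + fps_const (c (Suc N)) * 2 * u ^ Suc N + fps_const (c (Suc N)) * u ^ (Suc N + 1)"
      by (simp add: algebra_simps)
    show ?case unfolding split Suc double by (simp del: fps_const_neg)
  qed
  have uX: "u = fps_X * Abs_fps (\<lambda>k. 1 / fact (k + 1))"
  proof (rule fps_ext)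
    show "fps_nth u k = fps_nth (fps_X * Abs_fps (\<lambda>k. 1 / fact (k + 1))) k" for k
      by (cases k) (simp_all add: u_def algebra_simps)
  qed
  have Hn: "fps_nth H n = (\<Sum>i\<le>N. c i * fps_nth (u ^ i) n)" if "n \<le> N" for n
  proof -
    have uN: "u ^ (N + 1) = fps_X ^ (N + 1) * Abs_fps (\<lambda>k. 1 / fact (k + 1)) ^ (N + 1)"
      by (subst uX) (rule power_mult_distrib)
    have "S = H * ((u + 2) * S)" using H by (simp add: mult.assoc[symmetric])
    then have "S = H + fps_X ^ (N + 1) * (H * fps_const (c N) * Abs_fps (\<lambda>k. 1 / fact (k + 1)) ^ (N + 1))"
      unfolding S uN by (simp only: distrib_left mult_1_right mult_1_left mult_ac)
    then have "fps_nth S n = fps_nth H n"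
      using that by (simp add: fps_X_power_mult_nth del: power_Suc)
    then show ?thesis by (simp add: S_def fps_sum_nth)
  qed
  have un: "fact n * fps_nth (u ^ i) n = (\<Sum>m\<le>N. of_nat (i choose m) * (- 1) ^ (i - m) * of_nat m ^ n)"
    if "i \<le> N" for i n
  proof -
    have "u ^ i = (\<Sum>m\<le>i. of_nat (i choose m) * fps_exp 1 ^ m * (- 1) ^ (i - m))"
      unfolding u_def using binomial_ring[of "fps_exp 1" "- 1 :: rat fps" i] by simp
    also have "\<dots> = (\<Sum>m\<le>i. fps_const (of_nat (i choose m) * (- 1) ^ (i - m)) * fps_exp (of_nat m))"
      by (intro sum.cong refl)
         (simp add: fps_exp_power_mult fps_of_nat[symmetric] fps_const_mult[symmetric]
           fps_const_power[symmetric] fps_const_neg[symmetric] mult_ac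
           del: fps_const_mult fps_const_power fps_const_neg)
    finally have "fact n * fps_nth (u ^ i) n = (\<Sum>m\<le>i. of_nat (i choose m) * (- 1) ^ (i - m) * of_nat m ^ n)"
      by (simp add: fps_sum_nth sum_distrib_left mult_ac)
    also have "\<dots> = (\<Sum>m\<le>N. of_nat (i choose m) * (- 1) ^ (i - m) * of_nat m ^ n)"
      using that by (intro sum.mono_neutral_left) auto
    finally show ?thesis .
  qed
  define w where "w m = - (\<Sum>i\<le>N. c i * (of_nat (i choose m) * (- 1) ^ (i - m)))" for m
  have "integral (c i)" for i
  proof -
    have "\<not> p dvd 2 ^ (i + 1)"
      using prime_p p_ge prime_dvd_power[of p 2 "i + 1"] dvd_imp_le[of p 2] by auto
    then show ?thesis using integral_divide_nat[of "(- 1) ^ i" "2 ^ (i + 1)"]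
      by (simp add: c_def p_integral_power p_integral_uminus)
  qed
  then have wint: "integral (w m)" for m
    unfolding w_def by (intro p_integral_uminus p_integral_sum p_integral_mult p_integral_power) simp_all
  have "(2 ^ n - 1) * (bernoulli n / of_nat n) = (\<Sum>m\<le>N. w m * of_nat m ^ (n - 1))"
    if n: "n \<in> {1..N}" for n
  proof -
    have "fact n = of_nat n * (fact (n - 1) :: rat)" using n by (simp add: fact_reduce)
    then have "(2 ^ n - 1) * (bernoulli n / of_nat n)
        = fact (n - 1) * ((2 ^ n - 1) * fps_nth bernoulli_fps n)"
      using n by (simp add: bernoulli_nth)
    also have "\<dots> = - (\<Sum>i\<le>N. c i * (fact (n - 1) * fps_nth (u ^ i) (n - 1)))"
    proof -
      have "fps_nth H (n - 1) = (\<Sum>i\<le>N. c i * fps_nth (u ^ i) (n - 1))" using n by (intro Hn) auto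
      moreover have "(2 ^ n - 1) * fps_nth bernoulli_fps n = - fps_nth H (n - 1)" using n by (intro GB) auto
      ultimately show ?thesis by (simp only:) (simp add: sum_distrib_left mult_ac)
    qed
    also have "\<dots> = - (\<Sum>i\<le>N. \<Sum>m\<le>N. c i * (of_nat (i choose m) * (- 1) ^ (i - m)) * of_nat m ^ (n - 1))"
      by (simp add: un sum_distrib_left mult_ac)
    also have "\<dots> = - (\<Sum>m\<le>N. \<Sum>i\<le>N. c i * (of_nat (i choose m) * (- 1) ^ (i - m)) * of_nat m ^ (n - 1))"
      by (subst sum.swap) simp
    also have "\<dots> = (\<Sum>m\<le>N. w m * of_nat m ^ (n - 1))"
      by (simp add: w_def sum_distrib_right sum_negf)
    finally show ?thesis .
  qed
  with wint show ?thesis by (rule that)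
qed


section \<open>Kummer congruences\<close>

lemma integral_power_over:
  assumes "m > 0" "m < p ^ (e + 1)" shows "integral (P ^ e / of_nat m)"
proof -
  have "\<not> is_unit p" using prime_p not_prime_unit by blast
  then obtain y where y: "m = p ^ multiplicity p m * y" "\<not> p dvd y"
    using assms(1) by (elim multiplicity_decompose'[rotated]) auto
  let ?v = "multiplicity p m"
  have "p ^ ?v \<le> m" using assms(1) by (intro dvd_imp_le multiplicity_dvd) auto
  then have "p ^ ?v < p ^ (e + 1)" using assms(2) by linarith
  then have v: "?v \<le> e" using p_ge by (subst (asm) power_strict_increasing_iff) auto
  have "P ^ e = P ^ ?v * P ^ (e - ?v)" using v by (simp add: power_add[symmetric])
  moreover have "(of_nat m :: rat) = P ^ ?v * of_nat y" using y(1) by (metis of_nat_mult of_nat_power)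
  ultimately have "P ^ e / of_nat m = P ^ (e - ?v) / of_nat y" by simp
  then show ?thesis using integral_divide_nat[OF _ y(2)] by (simp add: p_integral_power)
qed

text \<open>
  The weak form of the theorem of von Staudt and Clausen, by induction: in Faulhaber's formula for
  \<open>\<Sum>a<p. a\<^sup>n\<close> the leading term is \<open>p B\<^sub>n\<close>, and in the others the factor \<open>p\<^sup>k / (k + 1)\<close> is
  \<open>p\<close>-integral.
\<close>

lemma integral_p_bernoulli: "integral (P * bernoulli n)"
proof (induction n rule: less_induct)
  case (less n)
  define c where "c k = of_nat (n choose k) * (P * bernoulli (n - k)) * (P ^ k / of_nat (k + 1))" for k
  have "(\<Sum>a<p. of_nat a ^ n) = (\<Sum>k\<le>n. c k)"
    unfolding sum_powers_bernoulli c_def by (intro sum.cong refl) simp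
  also have "\<dots> = c 0 + (\<Sum>k\<in>{1..n}. c k)"
    by (simp add: atMost_atLeast0 sum.atLeast_Suc_atMost)
  finally have "P * bernoulli n = (\<Sum>a<p. of_nat a ^ n) - (\<Sum>k\<in>{1..n}. c k)"
    by (simp add: c_def)
  moreover have "integral (c k)" if "k \<in> {1..n}" for k
  proof -
    have "k + 1 < p ^ (k + 1)" using p_ge by (intro power_gt_expt) auto
    then have "integral (P ^ k / of_nat (k + 1))" by (intro integral_power_over) auto
    moreover have "integral (P * bernoulli (n - k))" using that by (intro less) auto
    ultimately show ?thesis unfolding c_def by (metis p_integral_mult p_integral_of_nat)
  qed
  ultimately show ?case
    by (simp only:) (intro p_integral_diff p_integral_sum p_integral_power p_integral_of_nat)
qed

lemma fermat_quotient:
  assumes "\<not> p dvd a"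
  obtains q where "integral q" "of_nat a ^ (p - 1) = 1 + P * q"
proof -
  have "[a ^ (p - 1) = 1] (mod p)" using fermat_theorem[OF prime_p assms] .
  then have "[1 = int a ^ (p - 1)] (mod int p)"
    by (metis cong_int_iff cong_sym of_nat_1 of_nat_power)
  then obtain k where "int a ^ (p - 1) = 1 + int p * k" by (auto simp: cong_iff_lin)
  then have "(of_int (int a ^ (p - 1)) :: rat) = of_int (1 + int p * k)" by simp
  then show ?thesis by (intro that[of "of_int k"]) simp_all
qed

lemma index_ge: "j \<in> {1..6} \<Longrightarrow> p - 1 \<le> j * (p - 1)"
  by auto

text \<open>
  For \<open>m\<close> prime to \<open>p\<close> the exponents differ by multiples of \<open>p - 1\<close>, so the powers of \<open>m\<close> are a constant
  times powers of the principal unit \<open>m\<^bsup>p-1\<^esup>\<close>. For \<open>m\<close> divisible by \<open>p\<close> the exponent is at least \<open>K\<close>, by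
  the bound on \<open>K\<close>, and the values vanish modulo \<open>p\<^sup>K\<close>.
\<close>

lemma interpolates_power_residue:
  assumes "K + d + 2 \<le> p"
  obtains v where "interpolates K (\<lambda>j. of_nat m ^ (j * (p - 1) - d - 1)) v"
proof (cases "p dvd m")
  case True
  then obtain r where r: "m = p * r" by blast
  have "qcong K (of_nat m ^ (j * (p - 1) - d - 1)) 0" if j: "j \<in> {1..6}" for j
  proof -
    have "K \<le> j * (p - 1) - d - 1" using index_ge[OF j] assms by linarith
    then obtain e where e: "j * (p - 1) - d - 1 = K + e" using le_Suc_ex by blast
    have "(of_nat m :: rat) ^ (j * (p - 1) - d - 1) = 0 + P ^ K * (P ^ e * of_nat r ^ (K + e))"
      unfolding e r by (simp add: power_mult_distrib power_add mult_ac)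
    then show ?thesis by (rule qcongI) (intro p_integral_mult p_integral_power; simp)
  qed
  then have "interpolates K (\<lambda>j. of_nat m ^ (j * (p - 1) - d - 1)) 0"
    by (intro interpolates_cong[OF interpolates_const[of 0]]) auto
  then show ?thesis by (rule that)
next
  case False
  from fermat_quotient[OF False] obtain q where q: "integral q" "of_nat m ^ (p - 1) = 1 + P * q" .
  from interpolates_one_unit_power[OF q(1)] obtain v
    where "interpolates K (\<lambda>j. (1 + P * q) ^ (j - 1)) v" .
  then have "interpolates K (\<lambda>j. of_nat m ^ (p - 2 - d) * (1 + P * q) ^ (j - 1)) (of_nat m ^ (p - 2 - d) * v)"
    by (intro interpolates_cmult p_integral_power) auto
  moreover have "of_nat m ^ (p - 2 - d) * (1 + P * q) ^ (j - 1) = of_nat m ^ (j * (p - 1) - d - 1)"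
    if j: "j \<in> {1..6}" for j
  proof -
    have "j * (p - 1) = (p - 1) + (p - 1) * (j - 1)" using j by (cases j) auto
    then have "j * (p - 1) - d - 1 = (p - 2 - d) + (p - 1) * (j - 1)" using assms by linarith
    then show ?thesis by (simp only: power_add power_mult q(2))
  qed
  ultimately show ?thesis by (intro that) (auto elim!: interpolates_cong)
qed

text \<open>
  Modulo \<open>p\<close> the denominator is \<open>2\<^bsup>-d\<^esup> - 1\<close>. For \<open>d = 2, 4, 6\<close> it is a unit, because
  \<open>1 - 2\<^sup>d\<close> is \<open>-3\<close>, \<open>-3 \<cdot> 5\<close> or \<open>-9 \<cdot> 7\<close>. This is why the multiplier \<open>2\<close> suffices.
\<close>

lemma interpolates_two_power_minus_1:
  assumes d: "d \<in> {2, 4, 6}"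
  obtains v where "interpolates K (\<lambda>j. 1 / (2 ^ (j * (p - 1) - d) - 1)) v"
proof -
  have "\<not> p dvd 2" using p_ge dvd_imp_le[of p 2] by auto
  from fermat_quotient[OF this] obtain q where q: "integral q" "2 ^ (p - 1) = 1 + P * q"
    by auto
  define c :: rat where "c = 1 - 2 ^ d"
  have c: "integral (1 / c)" "c \<noteq> 0"
  proof -
    have "integral (- (1 / 3))" "integral (- (1 / 3 / 5))" "integral (- (1 / 9 / 7))"
      by (intro p_integral_uminus integral_divide_numeral; simp)+
    then show "integral (1 / c)" "c \<noteq> 0" using d by (auto simp: c_def)
  qed
  \<comment> \<open>\<open>2\<^sup>n - 1\<close> normalised to be \<open>1\<close> modulo \<open>p\<close>\<close>
  define f where "f j = 1 / c * ((1 + P * q) * (1 + P * q) ^ (j - 1) - 2 ^ d)" for j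
  from interpolates_one_unit_power[OF q(1)] obtain v
    where "interpolates K (\<lambda>j. (1 + P * q) ^ (j - 1)) v" .
  then have f: "interpolates K f (1 / c * ((1 + P * q) * v - 2 ^ d))"
    unfolding f_def using q(1) c(1)
    by (intro interpolates_cmult interpolates_diff interpolates_const p_integral_add p_integral_mult
        p_integral_power) auto
  have f_one: "qcong 1 (f j) 1" for j
  proof -
    have "qcong 1 (1 + P * q) 1" using q(1) by (intro qcongI[where r = q]) auto
    then have "qcong 1 ((1 + P * q) * (1 + P * q) ^ (j - 1)) (1 * 1 ^ (j - 1))"
      using q(1) by (intro qcong_mult qcong_power) auto
    then have "qcong 1 (f j) (1 / c * (1 * 1 ^ (j - 1) - 2 ^ d))"
      unfolding f_def by (intro qcong_cmult qcong_diff c) auto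
    then show ?thesis using c(2) by (simp add: c_def)
  qed
  from interpolates_inverse[OF f f_one] obtain w where "interpolates K (\<lambda>j. 1 / f j) w" by blast
  then have "interpolates K (\<lambda>j. 2 ^ d * (1 / c) * (1 / f j)) (2 ^ d * (1 / c) * w)"
    by (intro interpolates_cmult p_integral_mult p_integral_power c) auto
  moreover have "2 ^ d * (1 / c) * (1 / f j) = 1 / (2 ^ (j * (p - 1) - d) - 1)" if j: "j \<in> {1..6}" for j
  proof -
    have "d \<le> 6" using d by auto
    then have "d + (j * (p - 1) - d) = (p - 1) * j"
      using index_ge[OF j] p_ge mult.commute[of "p - 1" j] by linarith
    then have "2 ^ d * 2 ^ (j * (p - 1) - d) = (1 + P * q) ^ j"
      by (simp add: power_add[symmetric] power_mult q(2)[symmetric])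
    moreover have "(1 + P * q) * (1 + P * q) ^ (j - 1) = (1 + P * q) ^ j" using j by (cases j) auto
    ultimately have "f j = 1 / c * (2 ^ d * (2 ^ (j * (p - 1) - d) - 1))"
      by (simp add: f_def right_diff_distrib)
    then show ?thesis using c(2) by simp
  qed
  ultimately show ?thesis by (intro that) (auto elim!: interpolates_cong)
qed

text \<open>
  Kummer congruences for the numbers \<open>B\<^sub>n / n\<close> with \<open>n \<equiv> - d\<close> modulo \<open>p - 1\<close>.
\<close>

theorem interpolates_bernoulli_shifted:
  assumes d: "d \<in> {2, 4, 6}" and K: "K + d + 2 \<le> p"
  obtains v where "interpolates K (\<lambda>j. divided_bernoulli_shifted p j d) v"
proof -
  obtain w where w: "\<And>m. integral (w m)"
    "\<And>n. n \<in> {1..6 * p} \<Longrightarrow>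
      (2 ^ n - 1) * (bernoulli n / of_nat n) = (\<Sum>m\<le>6 * p. w m * of_nat m ^ (n - 1))"
    using bernoulli_power_sum[of "6 * p"] by blast
  have "\<exists>v. interpolates K (\<lambda>j. of_nat m ^ (j * (p - 1) - d - 1)) v" for m
    using interpolates_power_residue[OF K] by blast
  then obtain v where v: "\<And>m. interpolates K (\<lambda>j. of_nat m ^ (j * (p - 1) - d - 1)) (v m)" by metis
  obtain u where u: "interpolates K (\<lambda>j. 1 / (2 ^ (j * (p - 1) - d) - 1)) u"
    using interpolates_two_power_minus_1[OF d] by blast
  have "interpolates K (\<lambda>j. 1 / (2 ^ (j * (p - 1) - d) - 1) *
      (\<Sum>m\<le>6 * p. w m * of_nat m ^ (j * (p - 1) - d - 1))) (u * (\<Sum>m\<le>6 * p. w m * v m))"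
    by (intro interpolates_mult[OF u] interpolates_sum interpolates_cmult v w)
  moreover have "1 / (2 ^ (j * (p - 1) - d) - 1) *
      (\<Sum>m\<le>6 * p. w m * of_nat m ^ (j * (p - 1) - d - 1)) = divided_bernoulli_shifted p j d"
    if j: "j \<in> {1..6}" for j
  proof -
    have "d \<le> 6" using d by auto
    then have "1 \<le> j * (p - 1) - d" using index_ge[OF j] p_ge by linarith
    moreover have "j * (p - 1) \<le> 6 * p" using j by (intro mult_mono) auto
    ultimately have n: "j * (p - 1) - d \<in> {1..6 * p}" by auto
    then have "(2 :: rat) ^ 0 < 2 ^ (j * (p - 1) - d)" by (intro power_strict_increasing) auto
    then have "(2 :: rat) ^ (j * (p - 1) - d) - 1 \<noteq> 0" by simp
    then show ?thesis
      unfolding w(2)[OF n, symmetric] divided_bernoulli_shifted_def by simp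
  qed
  ultimately show ?thesis by (intro that) (auto elim!: interpolates_cong)
qed


section \<open>Power sums and Fermat quotients\<close>

text \<open>
  The factor \<open>p\<^sup>l\<close> raises the precision of \<open>f\<close> by \<open>l\<close>. It also allows factors \<open>h\<close> that are polynomials of
  degree at most \<open>l\<close> in \<open>j\<close> rather than in \<open>p \<cdot> j\<close>.
\<close>

lemma interpolates_scale_mult:
  assumes h: "interpolates (l + K) (\<lambda>j. P ^ l * h j) w" and f: "interpolates K f v"
    and int: "\<And>j. j \<in> {1..6} \<Longrightarrow> integral (h j)"
  shows "interpolates (l + K) (\<lambda>j. P ^ l * h j * f j) (w * v)"
proof -
  from f obtain g where g: "integral_poly g" "poly g 0 = v"
    "\<And>j. j \<in> {1..6} \<Longrightarrow> qcong K (f j) (poly g (P * of_nat j))" by (elim interpolatesE) blast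
  then have "interpolates (l + K) (\<lambda>j. poly g (P * of_nat j)) v"
    unfolding interpolates_def by auto
  from interpolates_mult[OF h this]
  have "interpolates (l + K) (\<lambda>j. P ^ l * h j * poly g (P * of_nat j)) (w * v)" .
  moreover have "qcong (l + K) (P ^ l * h j * f j) (P ^ l * h j * poly g (P * of_nat j))"
    if "j \<in> {1..6}" for j
    using qcong_cmult[OF g(3)[OF that] int[OF that]] by (simp add: qcong_scale mult.assoc)
  ultimately show ?thesis by (rule interpolates_cong)
qed

text \<open>
  Only three terms of Faulhaber's formula survive modulo \<open>p\<^sup>7\<close>: those with \<open>k = 1, 3, 5\<close> contain an odd
  Bernoulli number, the one with \<open>k = 6\<close> is \<open>p\<^sup>7\<close> times a \<open>p\<close>-integral number, and for \<open>k \<ge> 7\<close> the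
  factor \<open>p\<^bsup>k-7\<^esup> / (k + 1)\<close> is \<open>p\<close>-integral.
\<close>

lemma qcong_power_sum:
  assumes j: "j \<in> {1..6}" and n: "n = j * (p - 1)"
  shows "qcong 7 (\<Sum>a<p. of_nat a ^ n)
    (P * bernoulli n + P ^ 3 * (of_nat (n choose 2) / 3 * bernoulli (n - 2))
      + P ^ 5 * (of_nat (n choose 4) / 5 * bernoulli (n - 4)))"
proof -
  define c where "c k = of_nat (n choose k) * bernoulli (n - k) * P ^ (k + 1) / of_nat (k + 1)" for k
  have n10: "10 \<le> n" using index_ge[OF j] p_ge unfolding n by linarith
  have "even n" using prime_p p_ge prime_odd_nat[of p] unfolding n by auto
  then have odd: "bernoulli (n - k) = 0" if "k \<in> {1, 3, 5}" for k
    using that n10 by (intro bernoulli_odd_eq_0) auto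
  have "(\<Sum>a<p. of_nat a ^ n) = (\<Sum>k\<le>n. c k)"
    unfolding c_def by (rule sum_powers_bernoulli)
  also have "{..n} = {..6} \<union> {7..n}" using n10 by auto
  also have "(\<Sum>k\<in>{..6} \<union> {7..n}. c k) = (\<Sum>k\<le>6. c k) + (\<Sum>k\<in>{7..n}. c k)"
    by (rule sum.union_disjoint) auto
  also have "(\<Sum>k\<le>6. c k) = c 0 + c 2 + c 4 + c 6"
    by (simp add: atMost_nat_numeral atMost_Suc c_def odd numeral_eq_Suc)
  finally have S: "(\<Sum>a<p. of_nat a ^ n) = c 0 + c 2 + c 4 + (c 6 + (\<Sum>k\<in>{7..n}. c k))"
    by simp
  have tail: "qcong 7 (c k) 0" if k: "k \<in> {7..n}" for k
  proof -
    obtain i where i: "k = 7 + i" using k le_Suc_ex by auto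
    have "8 + i < 11 ^ (1 + i)" by (induction i) auto
    also have "\<dots> \<le> p ^ (i + 1)" using p_ge by (simp add: power_mono del: power_Suc)
    finally have "integral (P ^ i / of_nat (8 + i))" by (intro integral_power_over) auto
    moreover have "c k = 0 + P ^ 7 * (of_nat (n choose k) * (P * bernoulli (n - k)) * (P ^ i / of_nat (8 + i)))"
      by (simp add: c_def i power_add power_numeral_reduce)
    ultimately show ?thesis
      by (metis qcongI p_integral_mult p_integral_of_nat integral_p_bernoulli)
  qed
  have six: "qcong 7 (c 6) 0"
  proof -
    obtain v where v: "interpolates 1 (\<lambda>j. divided_bernoulli_shifted p j 6) v"
      using interpolates_bernoulli_shifted[of 6 1] p_ge by auto
    have "integral (bernoulli (n - 6) / of_nat (n - 6))"
      using interpolates_integral[OF v j] by (simp add: divided_bernoulli_shifted_def n)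
    then have "integral (of_nat (n - 6) * (bernoulli (n - 6) / of_nat (n - 6)))" by blast
    then have "integral (bernoulli (n - 6))" using n10 by simp
    then have "integral (of_nat (n choose 6) * bernoulli (n - 6) / 7)"
      by (intro integral_divide_numeral) auto
    moreover have "c 6 = 0 + P ^ 7 * (of_nat (n choose 6) * bernoulli (n - 6) / 7)"
      by (simp add: c_def)
    ultimately show ?thesis by (blast intro: qcongI)
  qed
  have "qcong 7 (c 6 + (\<Sum>k\<in>{7..n}. c k)) (0 + (\<Sum>k\<in>{7..n}. 0))"
    by (intro qcong_add qcong_sum six tail) auto
  then have "qcong 7 (\<Sum>a<p. of_nat a ^ n) (c 0 + c 2 + c 4 + 0)"
    unfolding S by (intro qcong_add) auto
  also have "c 0 + c 2 + c 4 + 0 = P * bernoulli n + P ^ 3 * (of_nat (n choose 2) / 3 * bernoulli (n - 2))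
      + P ^ 5 * (of_nat (n choose 4) / 5 * bernoulli (n - 4))"
    by (simp add: c_def mult_ac)
  finally show ?thesis .
qed

definition fermat_q :: "nat \<Rightarrow> rat" where
  "fermat_q a = (of_nat a ^ (p - 1) - 1) / P"

lemma fermat_q:
  assumes "a \<in> {1..<p}"
  shows "integral (fermat_q a)" "of_nat a ^ (p - 1) = 1 + P * fermat_q a"
proof -
  have "\<not> p dvd a" using assms by (auto dest: nat_dvd_not_less)
  from fermat_quotient[OF this] obtain q where "integral q" "of_nat a ^ (p - 1) = 1 + P * q" .
  then show "integral (fermat_q a)" "of_nat a ^ (p - 1) = 1 + P * fermat_q a"
    by (simp_all add: fermat_q_def)
qed

text \<open>
  The sums of powers of the Fermat quotients link both sides of the theorem: they are the coefficients
  of the power sums with respect to the binomial coefficients in \<open>j\<close>, and they are what the logarithm of \<open>- (p - 1)!\<close> is made of.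
\<close>

definition fermat_moment :: "nat \<Rightarrow> rat" where
  "fermat_moment k = (\<Sum>a\<in>{1..<p}. fermat_q a ^ k)"

lemma integral_fermat_moment: "integral (fermat_moment k)"
  unfolding fermat_moment_def by (intro p_integral_sum p_integral_power fermat_q)

lemma power_sum_fermat:
  assumes j: "j \<in> {1..6}"
  shows "(\<Sum>a<p. of_nat a ^ (j * (p - 1)))
    = P - 1 + (\<Sum>i<6. of_nat j * of_nat ((j - 1) choose i) * P ^ (i + 1) * fermat_moment (i + 1) / of_nat (i + 1))"
proof -
  have "(\<Sum>a<p. of_nat a ^ (j * (p - 1))) = (\<Sum>a\<in>{1..<p}. of_nat a ^ (j * (p - 1)) :: rat)"
    using j p_ge by (intro sum.mono_neutral_right) (auto simp: zero_power)
  also have "\<dots> = (\<Sum>a\<in>{1..<p}. \<Sum>k\<le>6. of_nat (j choose k) * P ^ k * fermat_q a ^ k)"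
  proof (intro sum.cong refl)
    fix a assume a: "a \<in> {1..<p}"
    have "(of_nat a :: rat) ^ (j * (p - 1)) = (P * fermat_q a + 1) ^ j"
      using fermat_q(2)[OF a] by (simp add: mult.commute[of j] power_mult add.commute)
    also have "\<dots> = (\<Sum>k\<le>j. of_nat (j choose k) * (P * fermat_q a) ^ k)"
      by (subst binomial_ring) simp
    also have "\<dots> = (\<Sum>k\<le>6. of_nat (j choose k) * (P * fermat_q a) ^ k)"
      using j by (intro sum.mono_neutral_left) auto
    finally show "(of_nat a :: rat) ^ (j * (p - 1)) = (\<Sum>k\<le>6. of_nat (j choose k) * P ^ k * fermat_q a ^ k)"
      by (simp add: power_mult_distrib mult.assoc)
  qed
  also have "\<dots> = (\<Sum>k\<le>6. of_nat (j choose k) * P ^ k * fermat_moment k)"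
    by (subst sum.swap) (simp add: fermat_moment_def sum_distrib_left)
  also have "{..6} = {..<Suc 6}" by auto
  also have "(\<Sum>k<Suc 6. of_nat (j choose k) * P ^ k * fermat_moment k)
      = fermat_moment 0 + (\<Sum>i<6. of_nat (j choose Suc i) * P ^ Suc i * fermat_moment (Suc i))"
    by (subst sum.lessThan_Suc_shift) simp
  also have "fermat_moment 0 = P - 1"
    using p_ge by (simp add: fermat_moment_def of_nat_diff)
  also have "(\<Sum>i<6. of_nat (j choose Suc i) * P ^ Suc i * fermat_moment (Suc i))
      = (\<Sum>i<6. of_nat j * of_nat ((j - 1) choose i) * P ^ (i + 1) * fermat_moment (i + 1) / of_nat (i + 1))"
  proof (intro sum.cong refl)
    fix i
    have "Suc i * (j choose Suc i) = j * ((j - 1) choose i)"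
      using times_binomial_minus1_eq[of "Suc i" j] by (simp del: binomial_Suc_Suc)
    then have "(of_nat (Suc i) * of_nat (j choose Suc i) :: rat) = of_nat j * of_nat ((j - 1) choose i)"
      by (metis of_nat_mult)
    then have "(of_nat (j choose Suc i) :: rat) = of_nat j * of_nat ((j - 1) choose i) / of_nat (Suc i)"
      by (simp add: field_simps del: of_nat_Suc)
    then show "of_nat (j choose Suc i) * P ^ Suc i * fermat_moment (Suc i)
      = of_nat j * of_nat ((j - 1) choose i) * P ^ (i + 1) * fermat_moment (i + 1) / of_nat (i + 1)"
      by simp
  qed
  finally show ?thesis .
qed

text \<open>
  Modulo \<open>p\<^sup>7\<close> this is the \<open>p\<close>-adic logarithm of \<open>- (p - 1)!\<close>, namely
  \<open>1/(p - 1) \<cdot> \<Sum>a. log (a\<^bsup>p-1\<^esup>)\<close> with \<open>a\<^bsup>p-1\<^esup> = 1 + p q\<^sub>a\<close> and the logarithmic series cut off after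
  the sixth term. In the same sense it is \<open>1/(p - 1)\<close> times the derivative at \<open>j = 0\<close> of \<open>\<Sum>a. a\<^bsup>j(p-1)\<^esup>\<close>.
\<close>

definition fermat_log :: rat where
  "fermat_log = (\<Sum>i<6. (- 1) ^ i * P ^ (i + 1) * fermat_moment (i + 1) / of_nat (i + 1)) / of_nat (p - 1)"

text \<open>
  Solving the truncated Faulhaber formula for the divided Bernoulli number. The terms \<open>p - 1\<close> on both
  sides cancel, which is the purpose of the correction \<open>1/p - 1\<close> in its definition, and the rest can be divided
  by \<open>p \<cdot> j (p - 1)\<close>. Every remaining term interpolates; at \<open>j = 0\<close> the power sum
  contributes \<open>fermat_log / p\<close>, and the products \<open>(n - 1)(n - 2)\<close> and \<open>(n - 1) \<cdots> (n - 4)\<close> with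
  \<open>n = j (p - 1)\<close> become \<open>2\<close> and \<open>24\<close>. This is how the fractions \<open>1/3 = 2/6\<close> and
  \<open>1/5 = 24/120\<close> arise.
\<close>

theorem interpolates_divided_bernoulli:
  assumes y: "interpolates 4 (\<lambda>j. divided_bernoulli_shifted p j 2) y"
    and z: "interpolates 2 (\<lambda>j. divided_bernoulli_shifted p j 4) z"
  obtains x where "interpolates 6 (divided_bernoulli p) x"
    "fermat_log = P * x + P ^ 3 * y / 3 + P ^ 5 * z / 5"
proof -
  define N where "N j = (of_nat (j * (p - 1)) :: rat)" for j
  have NP: "N j = of_nat j * (P - 1)" for j using p_ge by (simp add: N_def of_nat_diff)
  have N_int: "integral (N j - of_nat i)" for i j by (auto simp: N_def)
  define t where "t i = fermat_moment (i + 1) / of_nat (i + 1) / of_nat (p - 1)" for i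
  have t: "integral (t i)" if "i < 6" for i
    unfolding t_def using that p_ge by (intro integral_divide_small integral_fermat_moment) auto
  define E where "E j = (\<Sum>i<6. t i * (P ^ i * of_nat ((j - 1) choose i)))" for j
  define F where "F j = P ^ 2 * ((N j - 1) * (N j - 2)) * divided_bernoulli_shifted p j 2" for j
  define G where "G j = P ^ 4 * ((N j - 1) * (N j - 2) * (N j - 3) * (N j - 4))
     * divided_bernoulli_shifted p j 4" for j
  \<comment> \<open>\<open>N j\<close> is linear in \<open>j\<close>, so one factor \<open>p\<close> turns it into a polynomial in \<open>p \<cdot> j\<close>\<close>
  have factor: "interpolates K (\<lambda>j. P * (N j - of_nat i)) (- (P * of_nat i))" for K i
  proof -
    have "interpolates K (\<lambda>j. P * (P * of_nat j) - P * of_nat j - P * of_nat i) (P * 0 - 0 - P * of_nat i)"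
      by (intro interpolates_diff interpolates_cmult interpolates_id interpolates_const) auto
    then show ?thesis by (simp add: NP algebra_simps)
  qed
  have E: "interpolates 6 E (\<Sum>i<6. t i * (- P) ^ i)"
    unfolding E_def using p_ge
    by (intro interpolates_sum interpolates_cmult interpolates_binomial t) auto
  have F: "interpolates 6 F (2 * P ^ 2 * y)"
  proof -
    have "interpolates (2 + 4) (\<lambda>j. P * (N j - of_nat 1) * (P * (N j - of_nat 2)))
        (- (P * of_nat 1) * - (P * of_nat 2))"
      by (intro interpolates_mult factor)
    then have h: "interpolates (2 + 4) (\<lambda>j. P ^ 2 * ((N j - 1) * (N j - 2))) (2 * P ^ 2)"
      by (simp add: power2_eq_square mult_ac)
    have "interpolates (2 + 4) F (2 * P ^ 2 * y)"
      unfolding F_def using N_int[of _ 1] N_int[of _ 2]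
      by (intro interpolates_scale_mult h y p_integral_mult) auto
    then show ?thesis by simp
  qed
  have G: "interpolates 6 G (24 * P ^ 4 * z)"
  proof -
    have "interpolates (4 + 2) (\<lambda>j. P * (N j - of_nat 1) * (P * (N j - of_nat 2))
         * (P * (N j - of_nat 3)) * (P * (N j - of_nat 4)))
        (- (P * of_nat 1) * - (P * of_nat 2) * - (P * of_nat 3) * - (P * of_nat 4))"
      by (intro interpolates_mult factor)
    then have h: "interpolates (4 + 2) (\<lambda>j. P ^ 4 * ((N j - 1) * (N j - 2) * (N j - 3) * (N j - 4))) (24 * P ^ 4)"
      by (simp add: power4_eq_xxxx mult_ac)
    have "interpolates (4 + 2) G (24 * P ^ 4 * z)"
      unfolding G_def using N_int[of _ 1] N_int[of _ 2] N_int[of _ 3] N_int[of _ 4]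
      by (intro interpolates_scale_mult h z p_integral_mult) auto
    then show ?thesis by simp
  qed
  define x where "x = (\<Sum>i<6. t i * (- P) ^ i) - 1 / 6 * (2 * P ^ 2 * y) - 1 / 120 * (24 * P ^ 4 * z)"
  have "interpolates 6 (\<lambda>j. E j - 1 / 6 * F j - 1 / 120 * G j) x"
    unfolding x_def
    by (intro interpolates_diff interpolates_cmult E F G integral_divide_numeral) auto
  moreover have "qcong 6 (divided_bernoulli p j) (E j - 1 / 6 * F j - 1 / 120 * G j)"
    if j: "j \<in> {1..6}" for j
  proof -
    define n where "n = j * (p - 1)"
    have n10: "10 \<le> n" using index_ge[OF j] p_ge unfolding n_def by linarith
    have Nn: "N j = of_nat n" by (simp add: N_def n_def)
    have N0: "N j \<noteq> 0" using n10 by (simp add: Nn)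
    have c2: "(of_nat (n choose 2) :: rat) = N j * (N j - 1) / 2"
      by (simp add: Nn binomial_gbinomial gbinomial_prod_rev numeral_eq_Suc)
    have c4: "(of_nat (n choose 4) :: rat) = N j * (N j - 1) * (N j - 2) * (N j - 3) / 24"
      by (simp add: Nn binomial_gbinomial gbinomial_prod_rev numeral_eq_Suc)
    have b0: "P * bernoulli n = N j * P * divided_bernoulli p j - 1 + P"
    proof -
      have "divided_bernoulli p j = (bernoulli n + 1 / P - 1) / N j"
        unfolding divided_bernoulli_def Nn n_def ..
      then show ?thesis using N0 by (simp add: field_simps)
    qed
    have b2: "bernoulli (n - 2) = (N j - 2) * divided_bernoulli_shifted p j 2"
      unfolding divided_bernoulli_shifted_def n_def[symmetric] Nn using n10 by (simp add: of_nat_diff)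
    have b4: "bernoulli (n - 4) = (N j - 4) * divided_bernoulli_shifted p j 4"
      unfolding divided_bernoulli_shifted_def n_def[symmetric] Nn using n10 by (simp add: of_nat_diff)
    have S: "(\<Sum>a<p. of_nat a ^ n) = P - 1 + P * N j * E j"
    proof -
      have "of_nat j * of_nat ((j - 1) choose i) * P ^ (i + 1) * fermat_moment (i + 1) / of_nat (i + 1)
          = P * N j * (t i * (P ^ i * of_nat ((j - 1) choose i)))" for i
        using p_ge by (simp add: t_def N_def)
      then show ?thesis unfolding n_def power_sum_fermat[OF j] E_def sum_distrib_left by simp
    qed
    have "qcong 7 (P - 1 + P * N j * E j) (N j * P * divided_bernoulli p j - 1 + P
      + P ^ 3 * (N j * (N j - 1) / 2 / 3 * ((N j - 2) * divided_bernoulli_shifted p j 2))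
      + P ^ 5 * (N j * (N j - 1) * (N j - 2) * (N j - 3) / 24 / 5 * ((N j - 4) * divided_bernoulli_shifted p j 4)))"
      using qcong_power_sum[OF j n_def] unfolding S b0 b2 b4 c2 c4 .
    then have "qcong (1 + 6) (P ^ 1 * (N j * E j))
       (P ^ 1 * (N j * (divided_bernoulli p j + 1 / 6 * F j + 1 / 120 * G j)))"
      unfolding F_def G_def qcong_def
      by (simp add: field_simps power_numeral_reduce)
    then have "qcong 6 (N j * E j) (N j * (divided_bernoulli p j + 1 / 6 * F j + 1 / 120 * G j))"
      unfolding qcong_scale by simp
    moreover have "integral (1 / N j)"
    proof -
      have "integral (1 / of_nat j / of_nat (p - 1))"
        using j p_ge by (intro integral_divide_small) auto
      then show ?thesis by (simp add: N_def)
    qed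
    ultimately have "qcong 6 (1 / N j * (N j * E j))
        (1 / N j * (N j * (divided_bernoulli p j + 1 / 6 * F j + 1 / 120 * G j)))"
      by (rule qcong_cmult)
    then have "qcong 6 (E j) (divided_bernoulli p j + 1 / 6 * F j + 1 / 120 * G j)"
      using N0 by simp
    from qcong_diff[OF qcong_sym[OF this] qcong_refl[of 6 "1 / 6 * F j + 1 / 120 * G j"]]
    show ?thesis by (simp add: algebra_simps)
  qed
  ultimately have "interpolates 6 (divided_bernoulli p) x" by (rule interpolates_cong)
  moreover have "fermat_log = P * x + P ^ 3 * y / 3 + P ^ 5 * z / 5"
  proof -
    have "fermat_log = P * (\<Sum>i<6. t i * (- P) ^ i)"
      unfolding fermat_log_def sum_divide_distrib sum_distrib_left
      by (intro sum.cong refl) (simp add: t_def power_minus[of P])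
    then show ?thesis by (simp add: x_def field_simps power_numeral_reduce)
  qed
  ultimately show ?thesis by (rule that)
qed


section \<open>Truncated exponential and logarithm\<close>

definition trunc_exp :: "rat poly" where
  "trunc_exp = [:1, 1, 1 / 2, 1 / 6, 1 / 24, 1 / 120, 1 / 720:]"

definition trunc_log :: "rat poly" where
  "trunc_log = [:0, 1, - 1 / 2, 1 / 3, - 1 / 4, 1 / 5, - 1 / 6:]"

lemma integral_trunc: "integral_poly trunc_exp" "integral_poly trunc_log"
  unfolding trunc_exp_def trunc_log_def
  by (intro integral_poly_pCons integral_poly_0 integral_divide_numeral p_integral_uminus; simp)+

text \<open>
  The identity \<open>exp (log (1 + X)) = 1 + X\<close> up to degree \<open>6\<close>, which is all that is visible modulo \<open>p\<^sup>7\<close> when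
  \<open>X\<close> is divisible by \<open>p\<close>.
\<close>

lemma trunc_exp_log_coeff:
  assumes "i < 7"
  shows "Polynomial.coeff (pcompose trunc_exp trunc_log) i = (if i \<le> 1 then 1 else 0)"
proof -
  have "i \<in> {0, 1, 2, 3, 4, 5, 6}" using assms by auto
  then show ?thesis
    unfolding trunc_exp_def trunc_log_def
    by (auto simp: pcompose_pCons coeff_pCons numeral_eq_Suc)
qed

lemma trunc_exp_log:
  assumes "integral q"
  shows "qcong 7 (poly trunc_exp (poly trunc_log (P * q))) (1 + P * q)"
proof -
  have "qcong 7 (poly (pcompose trunc_exp trunc_log) (P * q))
     (\<Sum>i<7. Polynomial.coeff (pcompose trunc_exp trunc_log) i * P ^ i * q ^ i)"
    by (intro poly_truncate integral_poly_pcompose integral_trunc assms)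
  also have "\<dots> = (\<Sum>i<7. (if i \<le> 1 then 1 else 0) * P ^ i * q ^ i)"
    by (intro sum.cong refl) (simp add: trunc_exp_log_coeff)
  also have "\<dots> = 1 + P * q" by (simp add: numeral_eq_Suc)
  finally show ?thesis by (simp add: poly_pcompose)
qed

text \<open>
  The functional equation fails only in products of total degree at least \<open>7\<close>.
\<close>

lemma trunc_exp_add:
  assumes "integral x" "integral y"
  shows "qcong 7 (poly trunc_exp (P * x) * poly trunc_exp (P * y)) (poly trunc_exp (P * (x + y)))"
proof (rule qcongI)
  let ?r = "\<Sum>i<7. \<Sum>j\<in>{7 - i..<7}. P ^ (i + j - 7) * (x ^ i / fact i) * (y ^ j / fact j)"
  show "poly trunc_exp (P * x) * poly trunc_exp (P * y) = poly trunc_exp (P * (x + y)) + P ^ 7 * ?r"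
    unfolding trunc_exp_def
    by (simp add: numeral_eq_Suc atLeastLessThanSuc lessThan_Suc) (simp add: field_simps)
  have "integral (z ^ i / fact i)" if "integral z" "i < 7" for z i
  proof -
    have "\<not> p dvd fact i" using prime_dvd_fact_iff[OF prime_p] that(2) p_ge by simp
    then show ?thesis using integral_divide_nat[of "z ^ i" "fact i"] that(1) by auto
  qed
  then show "integral ?r" using assms
    by (intro p_integral_sum p_integral_mult p_integral_power) auto
qed

lemma trunc_exp_sum:
  assumes "finite A" "\<And>a. a \<in> A \<Longrightarrow> integral (f a)"
  shows "qcong 7 (\<Prod>a\<in>A. poly trunc_exp (P * f a)) (poly trunc_exp (P * (\<Sum>a\<in>A. f a)))"
  using assms
proof (induction A rule: finite_induct)
  case empty
  then show ?case by (simp add: trunc_exp_def)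
next
  case (insert a A)
  have "qcong 7 (poly trunc_exp (P * f a) * (\<Prod>a\<in>A. poly trunc_exp (P * f a)))
      (poly trunc_exp (P * f a) * poly trunc_exp (P * sum f A))"
    using insert by (intro qcong_cmult integral_poly_value integral_trunc) auto
  also have "qcong 7 \<dots> (poly trunc_exp (P * (f a + sum f A)))"
    using insert by (intro trunc_exp_add p_integral_sum) auto
  finally show ?case using insert by simp
qed

text \<open>
  Since \<open>u\<^sup>m - v\<^sup>m\<close> is \<open>u - v\<close> times a sum of \<open>m\<close> terms that are \<open>1\<close> modulo \<open>p\<close>, and this sum is a unit,
  \<open>m\<close>-th roots of principal units are unique.
\<close>

lemma qcong_root:
  assumes int: "integral u" "integral v" and one: "qcong 1 u 1" "qcong 1 v 1"
    and eq: "qcong k (u ^ m) (v ^ m)" and m: "\<not> p dvd m"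
  shows "qcong k u v"
proof -
  define S where "S = (\<Sum>i<m. v ^ (m - Suc i) * u ^ i)"
  have S: "integral S" unfolding S_def using int by auto
  have "qcong 1 S (\<Sum>i<m. 1 ^ (m - Suc i) * 1 ^ i)"
    unfolding S_def using int by (intro qcong_sum qcong_mult qcong_power one) auto
  then have "qcong 1 S (of_int (int m))" by simp
  moreover have "\<not> int p dvd int m" using m by simp
  ultimately have unit: "integral (1 / S)" "S \<noteq> 0" using integral_near_one[OF S] by blast+
  have "u ^ m - v ^ m = (u - v) * S" unfolding S_def by (rule power_diff_sumr2)
  then have "u - v = 1 / S * (u ^ m - v ^ m)" using unit(2) by simp
  moreover have "qcong k (1 / S * (u ^ m - v ^ m)) (1 / S * (v ^ m - v ^ m))"
    by (intro qcong_cmult qcong_diff eq unit) auto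
  ultimately have "qcong k (u - v) 0" by simp
  from qcong_add[OF this qcong_refl[of k v]] show ?thesis by simp
qed

lemma wilson_quotient_eq: "(fact (p - 1) :: rat) = - 1 + P * of_int (wilson_quotient p)"
proof -
  have "[fact (p - 1) = - 1] (mod int p)" using wilson_theorem[OF prime_p] by simp
  then have "int p dvd fact (p - 1) + 1" by (simp add: cong_iff_dvd_diff)
  then have "fact (p - 1) + 1 = int p * wilson_quotient p" by (simp add: wilson_quotient_def)
  then have "(of_int (fact (p - 1) + 1) :: rat) = of_int (int p * wilson_quotient p)" by simp
  then show ?thesis by simp
qed

text \<open>
  The product of all \<open>a\<^bsup>p-1\<^esup>\<close> is \<open>(p - 1)!\<^bsup>p-1\<^esup> = (1 - p W)\<^bsup>p-1\<^esup>\<close>, because \<open>p - 1\<close> is even. Each factor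
  is the exponential of its logarithm, the logarithms add up to \<open>(p - 1)\<close> times the logarithm in
  question, and \<open>(p - 1)\<close>-th roots of principal units are unique.
\<close>

theorem wilson_exp_log:
  "qcong 7 (1 - P * of_int (wilson_quotient p)) (poly trunc_exp fermat_log)"
proof -
  define s where "s a = (\<Sum>i<6. (- 1) ^ i * P ^ i * fermat_q a ^ (i + 1) / of_nat (i + 1))" for a
  have s_int: "integral (s a)" if "a \<in> {1..<p}" for a
    unfolding s_def using fermat_q(1)[OF that] p_ge
    by (intro p_integral_sum integral_divide_small p_integral_mult p_integral_power p_integral_uminus) auto
  have s_log: "P * s a = poly trunc_log (P * fermat_q a)" for a
    by (simp add: s_def trunc_log_def numeral_eq_Suc algebra_simps)
  \<comment> \<open>the logarithm of \<open>- (p - 1)!\<close>, divided by \<open>p\<close>\<close>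
  define l where "l = (\<Sum>a\<in>{1..<p}. s a) / of_nat (p - 1)"
  have l_int: "integral l" unfolding l_def using p_ge
    by (intro integral_divide_small p_integral_sum s_int) auto
  have log: "fermat_log = P * l"
  proof -
    have "P * (\<Sum>a\<in>{1..<p}. s a) = (\<Sum>a\<in>{1..<p}. \<Sum>i<6. (- 1) ^ i * P ^ (i + 1) * fermat_q a ^ (i + 1) / of_nat (i + 1))"
      unfolding s_def sum_distrib_left by (intro sum.cong refl) simp
    also have "\<dots> = (\<Sum>i<6. (- 1) ^ i * P ^ (i + 1) * fermat_moment (i + 1) / of_nat (i + 1))"
      by (subst sum.swap) (simp add: fermat_moment_def sum_distrib_left sum_divide_distrib)
    finally show ?thesis by (simp add: fermat_log_def l_def)
  qed
  have "qcong 7 (\<Prod>a\<in>{1..<p}. of_nat a ^ (p - 1)) (\<Prod>a\<in>{1..<p}. poly trunc_exp (P * s a))"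
  proof (intro qcong_prod integral_poly_value integral_trunc p_integral_mult s_int p_integral_of_nat)
    fix a assume a: "a \<in> {1..<p}"
    show "qcong 7 (of_nat a ^ (p - 1)) (poly trunc_exp (P * s a))"
      unfolding s_log fermat_q(2)[OF a] by (rule qcong_sym[OF trunc_exp_log[OF fermat_q(1)[OF a]]])
  qed
  also have "qcong 7 \<dots> (poly trunc_exp (P * (\<Sum>a\<in>{1..<p}. s a)))"
    by (intro trunc_exp_sum s_int) auto
  also have "(\<Sum>a\<in>{1..<p}. s a) = (\<Sum>a\<in>{1..<p}. l)"
    using p_ge by (simp add: l_def)
  also have "qcong 7 (poly trunc_exp (P * (\<Sum>a\<in>{1..<p}. l))) (\<Prod>a\<in>{1..<p}. poly trunc_exp (P * l))"
    by (intro qcong_sym[OF trunc_exp_sum] l_int) auto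
  also have "\<dots> = poly trunc_exp (P * l) ^ (p - 1)" by simp
  also have "(\<Prod>a\<in>{1..<p}. (of_nat a :: rat) ^ (p - 1)) = (1 - P * of_int (wilson_quotient p)) ^ (p - 1)"
  proof -
    have "{1..<p} = {1..p - 1}" using p_ge by auto
    then have "(\<Prod>a\<in>{1..<p}. (of_nat a :: rat) ^ (p - 1)) = fact (p - 1) ^ (p - 1)"
      by (simp add: fact_prod prod_power_distrib)
    also have "even (p - 1)" using prime_p p_ge prime_odd_nat[of p] by auto
    then have "(fact (p - 1) :: rat) ^ (p - 1) = (- fact (p - 1)) ^ (p - 1)" by simp
    finally show ?thesis unfolding wilson_quotient_eq by simp
  qed
  finally have pow: "qcong 7 ((1 - P * of_int (wilson_quotient p)) ^ (p - 1)) (poly trunc_exp (P * l) ^ (p - 1))" .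
  have "qcong 7 (1 - P * of_int (wilson_quotient p)) (poly trunc_exp (P * l))"
  proof (rule qcong_root[OF _ _ _ _ pow])
    show "qcong 1 (1 - P * of_int (wilson_quotient p)) 1"
      by (rule qcongI[where r = "- of_int (wilson_quotient p)"]) auto
    show "qcong 1 (poly trunc_exp (P * l)) 1"
      using poly_truncate[OF integral_trunc(1) l_int, of 1] by (simp add: trunc_exp_def)
    show "\<not> p dvd p - 1" using p_ge by (auto dest: dvd_imp_le)
    show "integral (poly trunc_exp (P * l))" using l_int by (intro integral_poly_value integral_trunc) auto
  qed auto
  then show ?thesis by (simp only: log)
qed


section \<open>The coefficients of the expansion\<close>

lemma interpolates_truncated:
  assumes "interpolates M f v" "0 < K" "K \<le> M"
  obtains a u where "a 0 = v" "\<And>i. integral (a i)"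
    "\<And>j. u j = (\<Sum>i<K. a i * P ^ i * of_nat j ^ i)"
    "\<And>j. j \<in> {1..6} \<Longrightarrow> qcong K (f j) (u j)"
    "\<And>j. integral (u j)" "\<And>j. j \<in> {1..6} \<Longrightarrow> integral (f j)"
proof -
  obtain a where a: "a 0 = v" "\<And>i. integral (a i)"
    "\<And>j. j \<in> {1..6} \<Longrightarrow> qcong K (f j) (\<Sum>i<K. a i * P ^ i * of_nat j ^ i)"
    using interpolates_expand[OF interpolates_mono[OF assms(1,3)] assms(2)] by blast
  show ?thesis
  proof (rule that[of a "\<lambda>j. \<Sum>i<K. a i * P ^ i * of_nat j ^ i"])
    show "integral (\<Sum>i<K. a i * P ^ i * of_nat j ^ i)" for j
      using a(2) by (intro p_integral_sum p_integral_mult p_integral_power) auto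
  qed (use a interpolates_integral[OF assms(1)] in auto)
qed

lemmas qcong_intros = qcong_refl qcong_add qcong_diff qcong_uminus qcong_mult qcong_power

text \<open>
  In this and the following five lemmas the coefficient with index \<open>\<nu>\<close> is needed only modulo
  \<open>p\<^bsup>7-\<nu>\<^esup>\<close>. The functions are replaced by polynomials in \<open>p \<cdot> j\<close> of that precision, with unknown
  coefficients, and the stated combination of values at \<open>j \<ge> 1\<close> turns into the value at \<open>j = 0\<close> because all
  terms of positive degree below the precision cancel. The linear case is the classical fact that the sixth
  difference annihilates polynomials of degree below \<open>6\<close>. Where a remainder \<open>?r\<close> occurs, it collects
  the products of total degree at least \<open>7 - \<nu>\<close> in \<open>p\<close>.
\<close>

lemma linear_coefficient:
  assumes X: "interpolates 6 f x"
  shows "qcong 6 (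
      - 6 * f 1 + 15 * f 2 - 20 * f 3 + 15 * f 4 - 6 * f 5 + f 6) (- x)"
proof -
  obtain a u where a: "a 0 = x" "\<And>i. integral (a i)"
    and u: "\<And>j. u j = (\<Sum>i<6. a i * P ^ i * of_nat j ^ i)"
      "\<And>j. j \<in> {1..6} \<Longrightarrow> qcong 6 (f j) (u j)"
      "\<And>j. integral (u j)" "\<And>j. j \<in> {1..6} \<Longrightarrow> integral (f j)"
    using interpolates_truncated[OF X, of 6] by auto
  let ?e = "\<lambda>u.
      - 6 * u 1 + 15 * u 2 - 20 * u 3 + 15 * u 4 - 6 * u 5 + u 6"
  have "qcong 6 (?e f) (?e u)"
    by (intro qcong_intros u(2); (intro integral_intros u(3) u(4))?; simp)
  also have "?e u = - x"
    unfolding u(1) a(1)[symmetric]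
    by (simp add: numeral_eq_Suc) (simp add: field_simps)?
  finally show ?thesis .
qed

lemma quadratic_coefficient:
  assumes X: "interpolates 6 f x"
  shows "qcong 5 (
      f 1 * (- (13/2) * f 1 + 15 * f 2 - 9 * f 3 + 2 * f 4)
      + f 2 * (- (7/2) * f 2 + 3 * f 4 - f 5) - (1/2) * (f 3)^2) (- (x ^ 2 / 2))"
proof -
  obtain a u where a: "a 0 = x" "\<And>i. integral (a i)"
    and u: "\<And>j. u j = (\<Sum>i<5. a i * P ^ i * of_nat j ^ i)"
      "\<And>j. j \<in> {1..6} \<Longrightarrow> qcong 5 (f j) (u j)"
      "\<And>j. integral (u j)" "\<And>j. j \<in> {1..6} \<Longrightarrow> integral (f j)"
    using interpolates_truncated[OF X, of 5] by auto
  let ?e = "\<lambda>u.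
      u 1 * (- (13/2) * u 1 + 15 * u 2 - 9 * u 3 + 2 * u 4)
      + u 2 * (- (7/2) * u 2 + 3 * u 4 - u 5) - (1/2) * (u 3)^2"
  have "qcong 5 (?e f) (?e u)"
    by (intro qcong_intros u(2); (intro integral_intros u(3) u(4))?; simp)
  also have "qcong 5 (?e u) (- (x ^ 2 / 2))"
  proof (rule qcongI)
    let ?r = "-216 * P * a 2 * a 4 - 54 * P * a 3 ^ 2 - 852 * P ^ 2 * a 3 * a 4
      - 1872 * P ^ 3 * a 4 ^ 2 - 48 * a 1 * a 4 - 12 * a 2 * a 3"
    show "?e u = - (x ^ 2 / 2) + P ^ 5 * ?r"
      unfolding u(1) a(1)[symmetric]
      by (simp add: numeral_eq_Suc) (simp add: field_simps)
    show "integral ?r"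
      by (intro integral_intros a(2); simp)
  qed
  finally show ?thesis .
qed

lemma cubic_coefficient:
  assumes X: "interpolates 6 f x" and Y: "interpolates 4 g y"
  shows "qcong 4 (
      (f 1)^2 * (- (10/3) * f 1 + (15/2) * f 2 - 3 * f 3 + (1/2) * f 4)
      + (f 2)^2 * (- 3 * f 1 + (1/6) * f 2) + f 1 * f 2 * f 3
      - (4/3) * g 1 + 2 * g 2 - (4/3) * g 3 + (1/3) * g 4) (- (x ^ 3 / 6) - y / 3)"
proof -
  obtain a u where a: "a 0 = x" "\<And>i. integral (a i)"
    and u: "\<And>j. u j = (\<Sum>i<4. a i * P ^ i * of_nat j ^ i)"
      "\<And>j. j \<in> {1..6} \<Longrightarrow> qcong 4 (f j) (u j)"
      "\<And>j. integral (u j)" "\<And>j. j \<in> {1..6} \<Longrightarrow> integral (f j)"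
    using interpolates_truncated[OF X, of 4] by auto
  obtain b v where b: "b 0 = y" "\<And>i. integral (b i)"
    and v: "\<And>j. v j = (\<Sum>i<4. b i * P ^ i * of_nat j ^ i)"
      "\<And>j. j \<in> {1..6} \<Longrightarrow> qcong 4 (g j) (v j)"
      "\<And>j. integral (v j)" "\<And>j. j \<in> {1..6} \<Longrightarrow> integral (g j)"
    using interpolates_truncated[OF Y, of 4] by auto
  let ?e = "\<lambda>u v.
      (u 1)^2 * (- (10/3) * u 1 + (15/2) * u 2 - 3 * u 3 + (1/2) * u 4)
      + (u 2)^2 * (- 3 * u 1 + (1/6) * u 2) + u 1 * u 2 * u 3
      - (4/3) * v 1 + 2 * v 2 - (4/3) * v 3 + (1/3) * v 4"
  have "qcong 4 (?e f g) (?e u v)"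
    by (intro qcong_intros u(2) v(2); (intro integral_intros u(3) v(3) u(4) v(4))?; simp)
  also have "qcong 4 (?e u v) (- (x ^ 3 / 6) - y / 3)"
  proof (rule qcongI)
    let ?r = "30 * P * a 0 * a 2 * a 3 + 6 * P * a 1 * a 2 ^ 2 + 9 * P * a 1 ^ 2 * a 3
      + 60 * P ^ 2 * a 0 * a 3 ^ 2 + 56 * P ^ 2 * a 1 * a 2 * a 3 + 19 / 3 * P ^ 2 * a 2 ^ 3
      + 90 * P ^ 3 * a 1 * a 3 ^ 2 + 63 * P ^ 3 * a 2 ^ 2 * a 3 + 163 * P ^ 4 * a 2 * a 3 ^ 2
      + 117 * P ^ 5 * a 3 ^ 3 + 6 * a 0 * a 1 * a 3 + 2 * a 0 * a 2 ^ 2 + a 1 ^ 2 * a 2"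
    show "?e u v = - (x ^ 3 / 6) - y / 3 + P ^ 4 * ?r"
      unfolding u(1) v(1) a(1)[symmetric] b(1)[symmetric]
      by (simp add: numeral_eq_Suc) (simp add: field_simps)
    show "integral ?r"
      by (intro integral_intros a(2) b(2); simp)
  qed
  finally show ?thesis .
qed

lemma quartic_coefficient:
  assumes X: "interpolates 6 f x" and Y: "interpolates 4 g y"
  shows "qcong 3 (
      (f 1)^3 * (- (5/8) * f 1 + f 2 - (1/6) * f 3) - (1/4) * (f 1)^2 * (f 2)^2
      - f 1 * g 1 + f 2 * g 2 - (1/3) * f 3 * g 3) (- (x ^ 4 / 24) - x * y / 3)"
proof -
  obtain a u where a: "a 0 = x" "\<And>i. integral (a i)"
    and u: "\<And>j. u j = (\<Sum>i<3. a i * P ^ i * of_nat j ^ i)"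
      "\<And>j. j \<in> {1..6} \<Longrightarrow> qcong 3 (f j) (u j)"
      "\<And>j. integral (u j)" "\<And>j. j \<in> {1..6} \<Longrightarrow> integral (f j)"
    using interpolates_truncated[OF X, of 3] by auto
  obtain b v where b: "b 0 = y" "\<And>i. integral (b i)"
    and v: "\<And>j. v j = (\<Sum>i<3. b i * P ^ i * of_nat j ^ i)"
      "\<And>j. j \<in> {1..6} \<Longrightarrow> qcong 3 (g j) (v j)"
      "\<And>j. integral (v j)" "\<And>j. j \<in> {1..6} \<Longrightarrow> integral (g j)"
    using interpolates_truncated[OF Y, of 3] by auto
  let ?e = "\<lambda>u v.
      (u 1)^3 * (- (5/8) * u 1 + u 2 - (1/6) * u 3) - (1/4) * (u 1)^2 * (u 2)^2
      - u 1 * v 1 + u 2 * v 2 - (1/3) * u 3 * v 3"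
  have "qcong 3 (?e f g) (?e u v)"
    by (intro qcong_intros u(2) v(2); (intro integral_intros u(3) v(3) u(4) v(4))?; simp)
  also have "qcong 3 (?e u v) (- (x ^ 4 / 24) - x * y / 3)"
  proof (rule qcongI)
    let ?r = "-5 / 2 * P * a 0 * a 1 ^ 2 * a 2 - 2 * P * a 0 ^ 2 * a 2 ^ 2 - 1 / 8 * P * a 1 ^ 4
      - 12 * P * a 2 * b 2 - 13 / 2 * P ^ 2 * a 0 * a 1 * a 2 ^ 2
      - 3 / 2 * P ^ 2 * a 1 ^ 3 * a 2 - 25 / 6 * P ^ 3 * a 0 * a 2 ^ 3
      - 19 / 4 * P ^ 3 * a 1 ^ 2 * a 2 ^ 2 - 11 / 2 * P ^ 4 * a 1 * a 2 ^ 3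
      - 17 / 8 * P ^ 5 * a 2 ^ 4 - 1 / 6 * a 0 * a 1 ^ 3 - a 0 ^ 2 * a 1 * a 2 - 2 * a 1 * b 2
      - 2 * a 2 * b 1"
    show "?e u v = - (x ^ 4 / 24) - x * y / 3 + P ^ 3 * ?r"
      unfolding u(1) v(1) a(1)[symmetric] b(1)[symmetric]
      by (simp add: numeral_eq_Suc) (simp add: field_simps)
    show "integral ?r"
      by (intro integral_intros a(2) b(2); simp)
  qed
  finally show ?thesis .
qed

lemma quintic_coefficient:
  assumes X: "interpolates 6 f x" and Y: "interpolates 4 g y" and Z: "interpolates 2 h z"
  shows "qcong 2 (
      - (1/20) * (f 1)^5 + (1/24) * (f 1)^4 * f 2 - (1/3) * f 1 * f 2 * g 1
      - (1/2) * (f 1)^2 * g 2 + (2/3) * f 1 * f 2 * g 2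
      - (2/5) * h 1 + (1/5) * h 2) (- (x ^ 5 / 120) - x ^ 2 * y / 6 - z / 5)"
proof -
  obtain a u where a: "a 0 = x" "\<And>i. integral (a i)"
    and u: "\<And>j. u j = (\<Sum>i<2. a i * P ^ i * of_nat j ^ i)"
      "\<And>j. j \<in> {1..6} \<Longrightarrow> qcong 2 (f j) (u j)"
      "\<And>j. integral (u j)" "\<And>j. j \<in> {1..6} \<Longrightarrow> integral (f j)"
    using interpolates_truncated[OF X, of 2] by auto
  obtain b v where b: "b 0 = y" "\<And>i. integral (b i)"
    and v: "\<And>j. v j = (\<Sum>i<2. b i * P ^ i * of_nat j ^ i)"
      "\<And>j. j \<in> {1..6} \<Longrightarrow> qcong 2 (g j) (v j)"
      "\<And>j. integral (v j)" "\<And>j. j \<in> {1..6} \<Longrightarrow> integral (g j)"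
    using interpolates_truncated[OF Y, of 2] by auto
  obtain c w where c: "c 0 = z" "\<And>i. integral (c i)"
    and w: "\<And>j. w j = (\<Sum>i<2. c i * P ^ i * of_nat j ^ i)"
      "\<And>j. j \<in> {1..6} \<Longrightarrow> qcong 2 (h j) (w j)"
      "\<And>j. integral (w j)" "\<And>j. j \<in> {1..6} \<Longrightarrow> integral (h j)"
    using interpolates_truncated[OF Z, of 2] by auto
  let ?e = "\<lambda>u v w.
      - (1/20) * (u 1)^5 + (1/24) * (u 1)^4 * u 2 - (1/3) * u 1 * u 2 * v 1
      - (1/2) * (u 1)^2 * v 2 + (2/3) * u 1 * u 2 * v 2
      - (2/5) * w 1 + (1/5) * w 2"
  have "qcong 2 (?e f g h) (?e u v w)"
    by (intro qcong_intros u(2) v(2) w(2); (intro integral_intros u(3) v(3) w(3) u(4) v(4) w(4))?; simp)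
  also have "qcong 2 (?e u v w) (- (x ^ 5 / 120) - x ^ 2 * y / 6 - z / 5)"
  proof (rule qcongI)
    let ?r = "1 / 6 * P * a 0 ^ 2 * a 1 ^ 3 + P * a 1 ^ 2 * b 1 + 1 / 8 * P ^ 2 * a 0 * a 1 ^ 4
      + 1 / 30 * P ^ 3 * a 1 ^ 5 + a 0 * a 1 * b 1 + 1 / 12 * a 0 ^ 3 * a 1 ^ 2
      + 1 / 6 * a 1 ^ 2 * b 0"
    show "?e u v w = - (x ^ 5 / 120) - x ^ 2 * y / 6 - z / 5 + P ^ 2 * ?r"
      unfolding u(1) v(1) w(1) a(1)[symmetric] b(1)[symmetric] c(1)[symmetric]
      by (simp add: numeral_eq_Suc) (simp add: field_simps)
    show "integral ?r"
      by (intro integral_intros a(2) b(2) c(2); simp)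
  qed
  finally show ?thesis .
qed

lemma sextic_coefficient:
  assumes X: "interpolates 6 f x" and Y: "interpolates 4 g y" and Z: "interpolates 2 h z"
  shows "qcong 1 (
      - (1/720) * (f 1)^6 - (1/18) * (f 1)^3 * g 1 - (1/18) * (g 1)^2
      - (1/5) * f 1 * h 1) (- (x ^ 6 / 720) - x ^ 3 * y / 18 - y ^ 2 / 18 - x * z / 5)"
proof -
  obtain a u where a: "a 0 = x" "\<And>i. integral (a i)"
    and u: "\<And>j. u j = (\<Sum>i<1. a i * P ^ i * of_nat j ^ i)"
      "\<And>j. j \<in> {1..6} \<Longrightarrow> qcong 1 (f j) (u j)"
      "\<And>j. integral (u j)" "\<And>j. j \<in> {1..6} \<Longrightarrow> integral (f j)"
    using interpolates_truncated[OF X, of 1] by auto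
  obtain b v where b: "b 0 = y" "\<And>i. integral (b i)"
    and v: "\<And>j. v j = (\<Sum>i<1. b i * P ^ i * of_nat j ^ i)"
      "\<And>j. j \<in> {1..6} \<Longrightarrow> qcong 1 (g j) (v j)"
      "\<And>j. integral (v j)" "\<And>j. j \<in> {1..6} \<Longrightarrow> integral (g j)"
    using interpolates_truncated[OF Y, of 1] by auto
  obtain c w where c: "c 0 = z" "\<And>i. integral (c i)"
    and w: "\<And>j. w j = (\<Sum>i<1. c i * P ^ i * of_nat j ^ i)"
      "\<And>j. j \<in> {1..6} \<Longrightarrow> qcong 1 (h j) (w j)"
      "\<And>j. integral (w j)" "\<And>j. j \<in> {1..6} \<Longrightarrow> integral (h j)"
    using interpolates_truncated[OF Z, of 1] by auto
  let ?e = "\<lambda>u v w.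
      - (1/720) * (u 1)^6 - (1/18) * (u 1)^3 * v 1 - (1/18) * (v 1)^2
      - (1/5) * u 1 * w 1"
  have "qcong 1 (?e f g h) (?e u v w)"
    by (intro qcong_intros u(2) v(2) w(2); (intro integral_intros u(3) v(3) w(3) u(4) v(4) w(4))?; simp)
  also have "?e u v w = - (x ^ 6 / 720) - x ^ 3 * y / 18 - y ^ 2 / 18 - x * z / 5"
    unfolding u(1) v(1) w(1) a(1)[symmetric] b(1)[symmetric] c(1)[symmetric]
    by (simp add: numeral_eq_Suc) (simp add: field_simps)?
  finally show ?thesis .
qed


text \<open>
  Expansion of \<open>exp (p x + p\<^sup>3 y / 3 + p\<^sup>5 z / 5)\<close> by powers of \<open>p\<close>. Its coefficients, up to sign, are the
  values that the six given combinations of divided Bernoulli numbers must reproduce.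
\<close>

lemma wilson_quotient_expansion:
  assumes x: "interpolates 6 f x" and y: "interpolates 4 g y" and z: "interpolates 2 h z"
    and log: "fermat_log = P * x + P ^ 3 * y / 3 + P ^ 5 * z / 5"
  shows "qcong 6 (of_int (wilson_quotient p))
    (- x + P * (- (x ^ 2 / 2)) + P ^ 2 * (- (x ^ 3 / 6) - y / 3)
     + P ^ 3 * (- (x ^ 4 / 24) - x * y / 3) + P ^ 4 * (- (x ^ 5 / 120) - x ^ 2 * y / 6 - z / 5)
     + P ^ 5 * (- (x ^ 6 / 720) - x ^ 3 * y / 18 - y ^ 2 / 18 - x * z / 5))" (is "qcong 6 ?W ?t")
proof -
  have int: "integral x" "integral y" "integral z"
    using x y z by (auto simp: interpolates_def intro!: integral_poly_value)
  define u where "u = y / 3"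
  define w where "w = z / 5"
  have uw: "integral u" "integral w"
    unfolding u_def w_def by (intro integral_divide_numeral int; simp)+
  let ?E = "poly trunc_exp"
  have Eu: "qcong 7 (?E (P * (P ^ 2 * u))) (1 + P ^ 3 * u + P ^ 6 * u ^ 2 / 2)"
  proof (rule qcongI)
    let ?r = "P ^ 2 * u ^ 3 / 6 + P ^ 5 * u ^ 4 / 24 + P ^ 8 * u ^ 5 / 120 + P ^ 11 * u ^ 6 / 720"
    show "?E (P * (P ^ 2 * u)) = 1 + P ^ 3 * u + P ^ 6 * u ^ 2 / 2 + P ^ 7 * ?r"
      by (simp add: trunc_exp_def field_simps power_numeral_reduce)
    show "integral ?r" by (intro integral_intros uw; simp)
  qed
  have Ew: "qcong 7 (?E (P * (P ^ 4 * w))) (1 + P ^ 5 * w)"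
  proof (rule qcongI)
    let ?r = "P ^ 3 * w ^ 2 / 2 + P ^ 8 * w ^ 3 / 6 + P ^ 13 * w ^ 4 / 24 + P ^ 18 * w ^ 5 / 120
      + P ^ 23 * w ^ 6 / 720"
    show "?E (P * (P ^ 4 * w)) = 1 + P ^ 5 * w + P ^ 7 * ?r"
      by (simp add: trunc_exp_def field_simps power_numeral_reduce)
    show "integral ?r" by (intro integral_intros uw; simp)
  qed
  have "fermat_log = P * (x + P ^ 2 * u + P ^ 4 * w)"
    by (simp add: log u_def w_def field_simps power_numeral_reduce)
  also have "qcong 7 (?E (P * (x + P ^ 2 * u + P ^ 4 * w)))
      (?E (P * (x + P ^ 2 * u)) * ?E (P * (P ^ 4 * w)))"
    by (intro qcong_sym[OF trunc_exp_add] integral_intros int uw)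
  also have "qcong 7 \<dots> (?E (P * x) * ?E (P * (P ^ 2 * u)) * ?E (P * (P ^ 4 * w)))"
    by (intro qcong_mult qcong_sym[OF trunc_exp_add] qcong_refl integral_poly_value integral_trunc
        integral_intros int uw)
  also have "qcong 7 \<dots> (?E (P * x) * (1 + P ^ 3 * u + P ^ 6 * u ^ 2 / 2) * (1 + P ^ 5 * w))"
    by (intro qcong_mult Eu Ew qcong_refl integral_poly_value integral_trunc integral_intros int uw; simp)
  also have "?E (P * x) * (1 + P ^ 3 * u + P ^ 6 * u ^ 2 / 2) * (1 + P ^ 5 * w)
      = poly ([:1, x, x ^ 2 / 2, x ^ 3 / 6, x ^ 4 / 24, x ^ 5 / 120, x ^ 6 / 720:]
      * [:1, 0, 0, u, 0, 0, u ^ 2 / 2:] * [:1, 0, 0, 0, 0, w:]) (P * 1)" (is "_ = poly ?D _")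
  proof -
    have "?E (P * x) = poly [:1, x, x ^ 2 / 2, x ^ 3 / 6, x ^ 4 / 24, x ^ 5 / 120, x ^ 6 / 720:] (P * 1)"
      by (simp add: trunc_exp_def field_simps power_numeral_reduce)
    moreover have "1 + P ^ 3 * u + P ^ 6 * u ^ 2 / 2 = poly [:1, 0, 0, u, 0, 0, u ^ 2 / 2:] (P * 1)"
      by (simp add: field_simps power_numeral_reduce)
    moreover have "1 + P ^ 5 * w = poly [:1, 0, 0, 0, 0, w:] (P * 1)"
      by (simp add: field_simps power_numeral_reduce)
    ultimately show ?thesis by (simp only: poly_mult)
  qed
  also have "qcong 7 \<dots> (\<Sum>i<7. Polynomial.coeff ?D i * P ^ i * 1 ^ i)"
    by (intro poly_truncate integral_poly_mult integral_poly_pCons integral_poly_0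
        integral_intros int uw; simp)
  also have "\<dots> = 1 - P * ?t"
  proof -
    have "Polynomial.coeff ?D 0 = 1" "Polynomial.coeff ?D 1 = x" "Polynomial.coeff ?D 2 = x ^ 2 / 2"
      "Polynomial.coeff ?D 3 = x ^ 3 / 6 + u" "Polynomial.coeff ?D 4 = x ^ 4 / 24 + x * u"
      "Polynomial.coeff ?D 5 = x ^ 5 / 120 + x ^ 2 / 2 * u + w"
      "Polynomial.coeff ?D 6 = x ^ 6 / 720 + x ^ 3 / 6 * u + u ^ 2 / 2 + x * w"
      by (simp_all add: numeral_eq_Suc coeff_pCons)
    then have "(\<Sum>i<7. Polynomial.coeff ?D i * P ^ i * 1 ^ i)
        = 1 + x * P + x ^ 2 / 2 * P ^ 2 + (x ^ 3 / 6 + u) * P ^ 3 + (x ^ 4 / 24 + x * u) * P ^ 4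
          + (x ^ 5 / 120 + x ^ 2 / 2 * u + w) * P ^ 5
          + (x ^ 6 / 720 + x ^ 3 / 6 * u + u ^ 2 / 2 + x * w) * P ^ 6"
      by (simp add: lessThan_nat_numeral lessThan_Suc del: mult_pCons_left mult_pCons_right)
    also have "\<dots> = 1 - P * ?t"
      unfolding u_def w_def by (simp add: field_simps power_numeral_reduce)
    finally show ?thesis .
  qed
  finally have "qcong 7 (poly trunc_exp fermat_log) (1 - P * ?t)" .
  with wilson_exp_log have "qcong 7 (1 - P * ?W) (1 - P * ?t)" by (rule qcong_trans)
  from qcong_diff[OF qcong_refl[of 7 1] this] have "qcong (1 + 6) (P ^ 1 * ?W) (P ^ 1 * ?t)" by simp
  then show ?thesis by (simp only: qcong_scale)
qed

end

section \<open>Passage to \<open>p\<close>-adic integers\<close>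

lemma padic_ints_mod:
  assumes "x \<in> carrier (padic_ints p)" "m \<le> n"
  shows "x n mod int p ^ m = x m"
  using assms(2)
proof (induction n rule: dec_induct)
  case base
  then show ?case using padic_intsD(4)[OF assms(1)] by simp
next
  case (step n)
  have "x (Suc n) mod int p ^ m = x (Suc n) mod int p ^ n mod int p ^ m"
    using step.hyps by (simp add: mod_mod_cancel le_imp_power_dvd)
  then show ?case using step padic_intsD(3)[OF assms(1)] by simp
qed

lemma padic_of_rat_int: "padic_of_rat p (of_int a) n = a mod int p ^ n"
proof -
  have "p_integral p (of_int a)" by simp
  from padic_of_rat_cong[OF this quotient_of_rat_of_int, of n]
  have "padic_of_rat p (of_int a) n mod int p ^ n = a mod int p ^ n" by (simp add: cong_def)
  then show ?thesis by (simp add: padic_of_rat_def split: prod.splits)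
qed

text \<open>
  Congruence modulo \<open>p\<^sup>k\<close> only compares the residues modulo \<open>p\<^sup>k\<close>. For the nontrivial direction, a
  \<open>p\<close>-adic integer \<open>c\<close> with \<open>c\<^sub>k = 0\<close> is divisible by \<open>p\<^sup>k\<close>: its quotient has the residues
  \<open>c\<^sub>n\<^sub>+\<^sub>k / p\<^sup>k\<close>, with an index shifted by \<open>k\<close> to make up for the loss of precision.
\<close>

lemma padic_cong_iff:
  assumes p: "p > 0"
  shows "padic_cong p k a b \<longleftrightarrow>
    a \<in> carrier (padic_ints p) \<and> b \<in> carrier (padic_ints p) \<and> a k = b k"
proof (cases "a \<in> carrier (padic_ints p) \<and> b \<in> carrier (padic_ints p)")
  case True
  let ?Z = "padic_ints p"
  interpret cring ?Z by (rule cring_padic_ints[OF p])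
  define c where "c = a \<ominus>\<^bsub>?Z\<^esub> b"
  have c: "c \<in> carrier ?Z" using True by (simp add: c_def)
  have "c \<oplus>\<^bsub>?Z\<^esub> b = a" using True by (simp add: c_def minus_eq a_assoc l_neg)
  moreover have "(c \<oplus>\<^bsub>?Z\<^esub> b) k = (c k + b k) mod int p ^ k" by (simp add: padic_ints_def)
  ultimately have "[c k + b k = a k] (mod int p ^ k)"
    using padic_intsD(4)[of a p k] True by (simp add: cong_def)
  have ck: "a k = b k \<longleftrightarrow> c k = 0"
  proof
    assume "a k = b k"
    with \<open>[c k + b k = a k] (mod int p ^ k)\<close> have "[c k = 0] (mod int p ^ k)"
      by (simp add: cong_add_rcancel_0)
    then show "c k = 0" using padic_intsD(4)[OF c, of k] by (simp add: cong_def)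
  next
    assume "c k = 0"
    with \<open>[c k + b k = a k] (mod int p ^ k)\<close> show "a k = b k"
      using padic_intsD(4)[of a p k] padic_intsD(4)[of b p k] True by (simp add: cong_def)
  qed
  have elem: "(r \<otimes>\<^bsub>?Z\<^esub> padic_of_rat p (of_nat p ^ k)) n = (r n * int p ^ k) mod int p ^ n" for r n
    using padic_of_rat_int[of p "int p ^ k" n] by (simp add: padic_ints_def mod_mult_right_eq)
  have "c \<in> PIdl\<^bsub>?Z\<^esub> (padic_of_rat p (of_nat p ^ k)) \<longleftrightarrow> c k = 0"
  proof
    assume "c \<in> PIdl\<^bsub>?Z\<^esub> (padic_of_rat p (of_nat p ^ k))"
    then show "c k = 0" by (auto simp: cgenideal_def elem)
  next
    assume c0: "c k = 0"
    define r where "r n = c (n + k) div int p ^ k" for n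
    have cr: "c (n + k) = int p ^ k * r n" for n
      using padic_ints_mod[OF c, of k "n + k"] c0 mult_div_mod_eq[of "int p ^ k" "c (n + k)"]
      by (simp add: r_def)
    have "r \<in> carrier ?Z"
    proof -
      have "r (Suc n) mod int p ^ n = r n \<and> r n \<in> {0..<int p ^ n}" for n
      proof -
        have "int p ^ k * (r (Suc n) mod int p ^ n) = (int p ^ k * r (Suc n)) mod (int p ^ k * int p ^ n)"
          by (rule mult_mod_right)
        also have "\<dots> = int p ^ k * r n"
          using padic_intsD(3)[OF c, of "n + k"] cr[of n] cr[of "Suc n"]
          by (simp add: power_add mult.commute)
        finally have "r (Suc n) mod int p ^ n = r n" using p by simp
        moreover have "r (Suc n) mod int p ^ n \<in> {0..<int p ^ n}" using p by simp
        ultimately show ?thesis by simp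
      qed
      then show ?thesis by (simp add: padic_ints_def)
    qed
    moreover have "c = r \<otimes>\<^bsub>?Z\<^esub> padic_of_rat p (of_nat p ^ k)"
    proof
      fix n
      show "c n = (r \<otimes>\<^bsub>?Z\<^esub> padic_of_rat p (of_nat p ^ k)) n"
        unfolding elem using padic_ints_mod[OF c, of n "n + k"] cr[of n] by (simp add: mult.commute)
    qed
    ultimately show "c \<in> PIdl\<^bsub>?Z\<^esub> (padic_of_rat p (of_nat p ^ k))"
      unfolding cgenideal_def by blast
  qed
  with True ck show ?thesis by (simp add: padic_cong_def c_def)
qed (auto simp: padic_cong_def)

lemma padic_finsum_nth:
  assumes p: "p > 0" and A: "finite A" "\<And>i. i \<in> A \<Longrightarrow> f i \<in> carrier (padic_ints p)"
  shows "(\<Oplus>\<^bsub>padic_ints p\<^esub>i\<in>A. f i) n = (\<Sum>i\<in>A. f i n) mod int p ^ n"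
proof -
  interpret cring "padic_ints p" by (rule cring_padic_ints[OF p])
  show ?thesis using A
  proof (induction A rule: finite_induct)
    case empty
    show ?case by (simp only: finsum_empty) (simp add: padic_ints_def)
  next
    case (insert i A)
    then have step: "(\<Oplus>\<^bsub>padic_ints p\<^esub>i\<in>insert i A. f i) = f i \<oplus>\<^bsub>padic_ints p\<^esub> (\<Oplus>\<^bsub>padic_ints p\<^esub>i\<in>A. f i)"
      by (intro finsum_insert) auto
    have "(\<Oplus>\<^bsub>padic_ints p\<^esub>i\<in>insert i A. f i) n
        = (f i n + (\<Oplus>\<^bsub>padic_ints p\<^esub>i\<in>A. f i) n) mod int p ^ n"
      unfolding step by (simp add: padic_ints_def)
    then show ?case using insert by (simp add: mod_add_right_eq)
  qed
qed

context prime_ge_11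
begin

lemma qcong_padic_of_rat:
  assumes "integral r" shows "qcong n (of_int (padic_of_rat p r n)) r"
proof -
  obtain a b where q: "quotient_of r = (a, b)" by fastforce
  have b: "b > 0" "r = of_int a / of_int b" "coprime b (int p)"
    using quotient_of_denom_pos[OF q] quotient_of_div[OF q] assms q by (auto simp: p_integral_def)
  from padic_of_rat_cong[OF assms q, of n] obtain l where "a = b * padic_of_rat p r n + int p ^ n * l"
    by (auto simp: cong_iff_lin)
  then have "(of_int a :: rat) = of_int (b * padic_of_rat p r n + int p ^ n * l)" by simp
  then have "r = of_int (padic_of_rat p r n) + P ^ n * (of_int l / of_int b)"
    using b(1) by (subst (1) b(2)) (simp add: field_simps)
  then show ?thesis using p_integralI[OF b(3)] by (blast intro: qcong_sym qcongI)
qed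

lemma qcong_mod: "qcong n (of_int (a mod int p ^ n)) (of_int a)"
proof (rule qcong_sym, rule qcongI)
  have "(of_int a :: rat) = of_int (a mod int p ^ n + int p ^ n * (a div int p ^ n))"
    by (simp only: mod_mult_div_eq)
  then show "(of_int a :: rat) = of_int (a mod int p ^ n) + P ^ n * of_int (a div int p ^ n)"
    by (simp only: of_int_add of_int_mult of_int_power of_int_of_nat_eq)
qed simp

lemma qcong_int_imp_eq:
  assumes "qcong n (of_int a) (of_int b)" shows "a mod int p ^ n = b mod int p ^ n"
proof -
  from assms obtain r where r: "integral r" "(of_int a :: rat) = of_int b + P ^ n * r"
    by (auto simp: qcong_iff)
  from r(1) obtain c d where cd: "d \<noteq> 0" "coprime d (int p)" "r = of_int c / of_int d"
    by (rule p_integralE)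
  have "(of_int ((a - b) * d) :: rat) = of_int (int p ^ n * c)"
    using r(2) cd by (simp add: field_simps)
  then have "int p ^ n dvd (a - b) * d" by (metis dvd_triv_left of_int_eq_iff)
  moreover have "coprime (int p ^ n) d" using cd(2) by (simp add: coprime_commute)
  ultimately have "int p ^ n dvd a - b" by (simp add: coprime_dvd_mult_left_iff)
  then show ?thesis by (simp add: mod_eq_dvd_iff)
qed

text \<open>
  A \<open>p\<close>-adic congruence with a rational number becomes a congruence between rational numbers, the
  \<open>p\<close>-adic integer being represented by any sufficiently precise residue.
\<close>

lemma padic_cong_imp_qcong:
  assumes "padic_cong p k w (padic_of_rat p r)" "integral r" "k \<le> n"
  shows "qcong k (of_int (w n)) r"
proof -
  have w: "w \<in> carrier (padic_ints p)" "w k = padic_of_rat p r k"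
    using assms(1) by (auto simp: padic_cong_iff)
  have "qcong k (of_int (w n)) (of_int (w n mod int p ^ k))" by (rule qcong_sym[OF qcong_mod])
  also have "w n mod int p ^ k = padic_of_rat p r k"
    using padic_ints_mod[OF w(1) assms(3)] w(2) by simp
  also have "qcong k (of_int (padic_of_rat p r k)) r" by (rule qcong_padic_of_rat[OF assms(2)])
  finally show ?thesis .
qed

text \<open>
  The way back: a \<open>p\<close>-adic expansion only has to be checked on residues modulo \<open>p\<^sup>n\<close>.
\<close>

lemma padic_cong_expansion:
  assumes A: "finite A" and w: "\<And>i. i \<in> A \<Longrightarrow> w i \<in> carrier (padic_ints p)"
    and r: "integral r" "qcong n r (\<Sum>i\<in>A. of_int (w i n) * P ^ m i)"
  shows "padic_cong p n (padic_of_rat p r)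
    (\<Oplus>\<^bsub>padic_ints p\<^esub>i\<in>A. w i \<otimes>\<^bsub>padic_ints p\<^esub> padic_of_rat p (of_nat p ^ m i))"
proof -
  let ?Z = "padic_ints p"
  interpret cring ?Z by (rule cring_padic_ints) simp
  define f where "f i = w i \<otimes>\<^bsub>?Z\<^esub> padic_of_rat p (of_nat p ^ m i)" for i
  have f: "f i \<in> carrier ?Z" if "i \<in> A" for i
    unfolding f_def using w[OF that] by (intro m_closed padic_of_rat_closed p_integral_power) auto
  have fn: "f i n = (w i n * int p ^ m i) mod int p ^ n" for i
    using padic_of_rat_int[of p "int p ^ m i" n] by (simp add: f_def padic_ints_def mod_mult_right_eq)
  have "qcong n (of_int (padic_of_rat p r n)) r" by (rule qcong_padic_of_rat[OF r(1)])
  also note r(2)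
  also have "(\<Sum>i\<in>A. of_int (w i n) * P ^ m i) = of_int (\<Sum>i\<in>A. w i n * int p ^ m i)" by simp
  finally have "padic_of_rat p r n mod int p ^ n = (\<Sum>i\<in>A. w i n * int p ^ m i) mod int p ^ n"
    by (rule qcong_int_imp_eq)
  also have "\<dots> = (\<Sum>i\<in>A. f i n) mod int p ^ n" by (simp add: fn mod_sum_eq)
  also have "\<dots> = (\<Oplus>\<^bsub>?Z\<^esub>i\<in>A. f i) n" using A f by (intro padic_finsum_nth[symmetric]) auto
  finally have "padic_of_rat p r n = (\<Oplus>\<^bsub>?Z\<^esub>i\<in>A. f i) n"
    using padic_intsD(4)[OF padic_of_rat_closed[OF _ r(1)]] by simp
  moreover have "(\<Oplus>\<^bsub>?Z\<^esub>i\<in>A. f i) \<in> carrier ?Z" using f by (intro finsum_closed) auto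
  ultimately show ?thesis unfolding f_def[symmetric]
    by (simp add: padic_cong_iff padic_of_rat_closed r(1))
qed

end

section \<open>The Wilson quotient modulo the sixth power\<close>

theorem theorem1p2:
  fixes p :: nat and \<omega> :: "nat \<Rightarrow> padic"
    and Zp :: "padic ring" and \<iota> :: "rat \<Rightarrow> padic"
    and B :: "nat \<Rightarrow> rat" and C :: "nat \<Rightarrow> nat \<Rightarrow> rat"
  defines "Zp \<equiv> padic_ints p"
    and "\<iota> \<equiv> padic_of_rat p"
    and "B \<equiv> divided_bernoulli p"
    and "C \<equiv> divided_bernoulli_shifted p"
  assumes "prime p" and "p \<ge> 11"
    and "\<forall>\<nu>\<in>{0..6}. \<omega> \<nu> \<in> carrier Zp"
    and "\<omega> 0 = \<iota> (-1)"
    and "padic_cong p 6 (\<omega> 1) (\<iota> (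
           - 6 * B 1 + 15 * B 2 - 20 * B 3 + 15 * B 4 - 6 * B 5 + B 6))"
    and "padic_cong p 5 (\<omega> 2) (\<iota> (
           B 1 * (- (13/2) * B 1 + 15 * B 2 - 9 * B 3 + 2 * B 4)
           + B 2 * (- (7/2) * B 2 + 3 * B 4 - B 5) - (1/2) * (B 3)^2))"
    and "padic_cong p 4 (\<omega> 3) (\<iota> (
           (B 1)^2 * (- (10/3) * B 1 + (15/2) * B 2 - 3 * B 3 + (1/2) * B 4)
           + (B 2)^2 * (- 3 * B 1 + (1/6) * B 2) + B 1 * B 2 * B 3
           - (4/3) * C 1 2 + 2 * C 2 2 - (4/3) * C 3 2 + (1/3) * C 4 2))"
    and "padic_cong p 3 (\<omega> 4) (\<iota> (
           (B 1)^3 * (- (5/8) * B 1 + B 2 - (1/6) * B 3) - (1/4) * (B 1)^2 * (B 2)^2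
           - B 1 * C 1 2 + B 2 * C 2 2 - (1/3) * B 3 * C 3 2))"
    and "padic_cong p 2 (\<omega> 5) (\<iota> (
           - (1/20) * (B 1)^5 + (1/24) * (B 1)^4 * B 2 - (1/3) * B 1 * B 2 * C 1 2
           - (1/2) * (B 1)^2 * C 2 2 + (2/3) * B 1 * B 2 * C 2 2
           - (2/5) * C 1 4 + (1/5) * C 2 4))"
    and "padic_cong p 1 (\<omega> 6) (\<iota> (
           - (1/720) * (B 1)^6 - (1/18) * (B 1)^3 * C 1 2 - (1/18) * (C 1 2)^2
           - (1/5) * B 1 * C 1 4))"
  shows "(\<forall>n\<in>{1..6}. p_integral p (B n)) \<and>
         (\<forall>n\<in>{1..4}. p_integral p (C n 2)) \<and>
         (\<forall>n\<in>{1..2}. p_integral p (C n 4)) \<and>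
         padic_cong p 6 (\<iota> (of_int (wilson_quotient p)))
           (\<Oplus>\<^bsub>Zp\<^esub>\<nu>\<in>{1..6}. \<omega> \<nu> \<otimes>\<^bsub>Zp\<^esub> \<iota> (of_nat p ^ (\<nu> - 1))) \<and>
         padic_cong p 7 (\<iota> (fact (p - 1)))
           (\<Oplus>\<^bsub>Zp\<^esub>\<nu>\<in>{0..6}. \<omega> \<nu> \<otimes>\<^bsub>Zp\<^esub> \<iota> (of_nat p ^ \<nu>))"
proof -
  interpret prime_ge_11 p using \<open>prime p\<close> \<open>p \<ge> 11\<close> by unfold_locales
  obtain y where Y: "interpolates 4 (\<lambda>j. C j 2) y"
    using interpolates_bernoulli_shifted[of 2 4] p_ge unfolding C_def by auto
  obtain z where Z: "interpolates 2 (\<lambda>j. C j 4) z"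
    using interpolates_bernoulli_shifted[of 4 2] p_ge unfolding C_def by auto
  obtain x where X: "interpolates 6 B x" and log: "fermat_log = P * x + P ^ 3 * y / 3 + P ^ 5 * z / 5"
    using interpolates_divided_bernoulli Y Z unfolding B_def C_def by blast
  have B_int: "integral (B n)" if "n \<in> {1..6}" for n using interpolates_integral[OF X that] .
  have C2_int: "integral (C n 2)" if "n \<in> {1..6}" for n using interpolates_integral[OF Y that] .
  have C4_int: "integral (C n 4)" if "n \<in> {1..6}" for n using interpolates_integral[OF Z that] .
  define t where "t = (!) [- 1, - x, - (x ^ 2 / 2), - (x ^ 3 / 6) - y / 3, - (x ^ 4 / 24) - x * y / 3,
      - (x ^ 5 / 120) - x ^ 2 * y / 6 - z / 5,
      - (x ^ 6 / 720) - x ^ 3 * y / 18 - y ^ 2 / 18 - x * z / 5]"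
  have t_simps: "t 1 = - x" "t 2 = - (x ^ 2 / 2)" "t 3 = - (x ^ 3 / 6) - y / 3"
    "t 4 = - (x ^ 4 / 24) - x * y / 3" "t 5 = - (x ^ 5 / 120) - x ^ 2 * y / 6 - z / 5"
    "t 6 = - (x ^ 6 / 720) - x ^ 3 * y / 18 - y ^ 2 / 18 - x * z / 5"
    by (simp_all add: t_def)
  have \<omega>_t: "qcong (7 - \<nu>) (of_int (\<omega> \<nu> n)) (t \<nu>)" if \<nu>: "\<nu> \<in> {1..6}" and n: "n \<ge> 6" for \<nu> n
  proof -
    note \<omega> = assms(9-14)[unfolded \<iota>_def, THEN padic_cong_imp_qcong]
    note ints = integral_intros B_int C2_int C4_int
    have t1: "qcong 6 (of_int (\<omega> 1 n)) (t 1)"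
      by (rule qcong_trans[OF \<omega>(1) linear_coefficient[OF X, folded t_simps]])
         ((intro ints; simp)+, use n in simp)
    have t2: "qcong 5 (of_int (\<omega> 2 n)) (t 2)"
      by (rule qcong_trans[OF \<omega>(2) quadratic_coefficient[OF X, folded t_simps]])
         ((intro ints; simp)+, use n in simp)
    have t3: "qcong 4 (of_int (\<omega> 3 n)) (t 3)"
      by (rule qcong_trans[OF \<omega>(3) cubic_coefficient[OF X Y, folded t_simps]])
         ((intro ints; simp)+, use n in simp)
    have t4: "qcong 3 (of_int (\<omega> 4 n)) (t 4)"
      by (rule qcong_trans[OF \<omega>(4) quartic_coefficient[OF X Y, folded t_simps]])
         ((intro ints; simp)+, use n in simp)
    have t5: "qcong 2 (of_int (\<omega> 5 n)) (t 5)"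
      by (rule qcong_trans[OF \<omega>(5) quintic_coefficient[OF X Y Z, folded t_simps]])
         ((intro ints; simp)+, use n in simp)
    have t6: "qcong 1 (of_int (\<omega> 6 n)) (t 6)"
      by (rule qcong_trans[OF \<omega>(6) sextic_coefficient[OF X Y Z, folded t_simps]])
         ((intro ints; simp)+, use n in simp)
    from \<nu> have "\<nu> \<in> {1, 2, 3, 4, 5, 6}" by auto
    with t1 t2 t3 t4 t5 t6 show ?thesis by (elim insertE emptyE) simp_all
  qed
  \<comment> \<open>the factor \<open>p\<^sup>l\<close> makes up for the lower precision at which the higher coefficients are given\<close>
  have scaled: "qcong (l + (7 - \<nu>)) (t \<nu> * P ^ l) (of_int (\<omega> \<nu> n) * P ^ l)"
    if "\<nu> \<in> {1..6}" "n \<ge> 6" for \<nu> n l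
    using qcong_sym[OF \<omega>_t[OF that]] by (simp add: qcong_scale mult.commute[of _ "P ^ l"])
  have W: "qcong 6 (of_int (wilson_quotient p)) (\<Sum>\<nu>\<in>{1..6}. t \<nu> * P ^ (\<nu> - 1))"
  proof -
    have "{1..6} = {1, 2, 3, 4, 5, 6 :: nat}" by auto
    then have "(\<Sum>\<nu>\<in>{1..6}. t \<nu> * P ^ (\<nu> - 1))
        = t 1 + P * t 2 + P ^ 2 * t 3 + P ^ 3 * t 4 + P ^ 4 * t 5 + P ^ 5 * t 6"
      by (simp add: mult.commute)
    then show ?thesis using wilson_quotient_expansion[OF X Y Z log] unfolding t_simps by simp
  qed
  have quotient: "padic_cong p 6 (\<iota> (of_int (wilson_quotient p)))
      (\<Oplus>\<^bsub>Zp\<^esub>\<nu>\<in>{1..6}. \<omega> \<nu> \<otimes>\<^bsub>Zp\<^esub> \<iota> (of_nat p ^ (\<nu> - 1)))"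
    unfolding Zp_def \<iota>_def
  proof (rule padic_cong_expansion)
    have "qcong 6 (\<Sum>\<nu>\<in>{1..6}. t \<nu> * P ^ (\<nu> - 1)) (\<Sum>\<nu>\<in>{1..6}. of_int (\<omega> \<nu> 6) * P ^ (\<nu> - 1))"
    proof (rule qcong_sum)
      fix \<nu> :: nat assume \<nu>: "\<nu> \<in> {1..6}"
      then have "\<nu> - 1 + (7 - \<nu>) = 6" by auto
      with scaled[OF \<nu>, of 6 "\<nu> - 1"] show "qcong 6 (t \<nu> * P ^ (\<nu> - 1)) (of_int (\<omega> \<nu> 6) * P ^ (\<nu> - 1))"
        by simp
    qed
    with W show "qcong 6 (of_int (wilson_quotient p)) (\<Sum>\<nu>\<in>{1..6}. of_int (\<omega> \<nu> 6) * P ^ (\<nu> - 1))"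
      by (rule qcong_trans)
  qed (use assms(7) in \<open>auto simp: Zp_def\<close>)
  have factorial: "padic_cong p 7 (\<iota> (fact (p - 1)))
      (\<Oplus>\<^bsub>Zp\<^esub>\<nu>\<in>{0..6}. \<omega> \<nu> \<otimes>\<^bsub>Zp\<^esub> \<iota> (of_nat p ^ \<nu>))"
    unfolding Zp_def \<iota>_def
  proof (rule padic_cong_expansion)
    show "integral (fact (p - 1))" using p_integral_of_nat[of p "fact (p - 1)"] by simp
    have "fact (p - 1) = - 1 + P ^ 1 * of_int (wilson_quotient p)" using wilson_quotient_eq by simp
    also have "qcong 7 \<dots> (- 1 + P ^ 1 * (\<Sum>\<nu>\<in>{1..6}. t \<nu> * P ^ (\<nu> - 1)))"
    proof (rule qcong_add[OF qcong_refl])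
      have "qcong (1 + 6) (P ^ 1 * of_int (wilson_quotient p)) (P ^ 1 * (\<Sum>\<nu>\<in>{1..6}. t \<nu> * P ^ (\<nu> - 1)))"
        unfolding qcong_scale by (rule W)
      then show "qcong 7 (P ^ 1 * of_int (wilson_quotient p)) (P ^ 1 * (\<Sum>\<nu>\<in>{1..6}. t \<nu> * P ^ (\<nu> - 1)))"
        by simp
    qed
    also have "P ^ 1 * (\<Sum>\<nu>\<in>{1..6}. t \<nu> * P ^ (\<nu> - 1)) = (\<Sum>\<nu>\<in>{1..6}. t \<nu> * P ^ \<nu>)"
      unfolding sum_distrib_left by (intro sum.cong refl) (auto simp: power_eq_if)
    also have "qcong 7 (- 1 + \<dots>) (of_int (\<omega> 0 7) + (\<Sum>\<nu>\<in>{1..6}. of_int (\<omega> \<nu> 7) * P ^ \<nu>))"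
    proof (intro qcong_add qcong_sum)
      have "integral (- 1)" by (intro integral_intros)
      from qcong_sym[OF qcong_padic_of_rat[OF this]] show "qcong 7 (- 1) (of_int (\<omega> 0 7))"
        unfolding assms(8) \<iota>_def .
    next
      fix \<nu> :: nat assume \<nu>: "\<nu> \<in> {1..6}"
      then have "\<nu> + (7 - \<nu>) = 7" by auto
      with scaled[OF \<nu>, of 7 \<nu>] show "qcong 7 (t \<nu> * P ^ \<nu>) (of_int (\<omega> \<nu> 7) * P ^ \<nu>)" by simp
    qed
    also have "of_int (\<omega> 0 7) + (\<Sum>\<nu>\<in>{1..6}. of_int (\<omega> \<nu> 7) * P ^ \<nu>)
        = (\<Sum>\<nu>\<in>{0..6}. of_int (\<omega> \<nu> 7) * P ^ \<nu>)"
      by (simp add: sum.atLeast_Suc_atMost[of 0 6])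
    finally show "qcong 7 (fact (p - 1)) (\<Sum>\<nu>\<in>{0..6}. of_int (\<omega> \<nu> 7) * P ^ \<nu>)" .
  qed (use assms(7) in \<open>auto simp: Zp_def\<close>)
  show ?thesis using B_int C2_int C4_int quotient factorial by auto
qed

end
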